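(* There is an absolute constant $c>0$ such that the following holds. Let $L>0$ and let $A\in\mathbb{R}^{n\times n}$ be symmetric and nonzero with every nonzero eigenvalue of magnitude at least $L$. Let $S\in\mathbb{R}^{k\times n}$ satisfy Assumption L for $A$ with parameter $L$. Then for every $i$ with $\lambda_i(A)>0$, $SAS^T$ has at least $i$ eigenvalues and $|\lambda_i(SAS^T)-\lambda_i(A)|\le cL\log\frac{2\|A\|}{L}$; and for every $i$ with $\mu_i(A)<0$, $SAS^T$ has at least $i$ eigenvalues and $|\mu_i(SAS^T)-\mu_i(A)|\le cL\log\frac{2\|A\|}{L}$.
   Context: $\lambda_i(M)$ denotes the $i$-th largest and $\mu_i(M)$ the $i$-th smallest eigenvalue of a symmetric matrix $M$; $\|A\|$ is the operator norm. $S$ is an $\alpha$-distortion subspace embedding for $X$ (or its column span) if $(1-\alpha)\|Xv\|^2\le\|SXv\|^2\le(1+\alpha)\|Xv\|^2$ for all $v$. Assumption L (for symmetric $A$ and $L>0$): for every $\lambda\ge L$, $S$ is a $\min(L/\lambda,1/10)$-distortion subspace embedding for the span of all eigenvectors of $A$ whose eigenvalue has magnitude at least $\lambda$. *)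

theory Defs
  imports "Jordan_Normal_Form.Char_Poly" "Jordan_Normal_Form.VS_Connect"
begin

definition eigs :: "real mat \<Rightarrow> real multiset" where
  "eigs M = proots (char_poly M)"

definition lam :: "real mat \<Rightarrow> nat \<Rightarrow> real" where
  "lam M i = rev (sorted_list_of_multiset (eigs M)) ! (i - 1)"

definition mu :: "real mat \<Rightarrow> nat \<Rightarrow> real" where
  "mu M i = sorted_list_of_multiset (eigs M) ! (i - 1)"

definition vnorm :: "real vec \<Rightarrow> real" where
  "vnorm v = sqrt (v \<bullet> v)"

definition opnorm :: "real mat \<Rightarrow> real" where
  "opnorm M = Sup {vnorm (M *\<^sub>v v) | v. v \<in> carrier_vec (dim_col M) \<and> vnorm v \<le> 1}"

definition subspace_embedding :: "real mat \<Rightarrow> real \<Rightarrow> real vec set \<Rightarrow> bool" where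
  "subspace_embedding S \<alpha> V \<longleftrightarrow>
     (\<forall>v\<in>V. (1 - \<alpha>) * (vnorm v)^2 \<le> (vnorm (S *\<^sub>v v))^2 \<and>
             (vnorm (S *\<^sub>v v))^2 \<le> (1 + \<alpha>) * (vnorm v)^2)"

definition top_eigspan :: "real mat \<Rightarrow> real \<Rightarrow> real vec set" where
  "top_eigspan A t = module.span class_ring (module_vec TYPE(real) (dim_row A))
      {v. \<exists>k. eigenvector A v k \<and> \<bar>k\<bar> \<ge> t}"

definition assumption_L :: "real mat \<Rightarrow> real mat \<Rightarrow> real \<Rightarrow> bool" where
  "assumption_L S A L \<longleftrightarrow>
     (\<forall>t \<ge> L. subspace_embedding S (min (L / t) (1/10)) (top_eigspan A t))"

end

theory Submission
  imports Defs "Jordan_Normal_Form.Schur_Decomposition"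
begin

text \<open>
  Write \<open>M = S A S\<^sup>T\<close> and \<open>r = \<lambda>\<^sub>i(A) > 0\<close>; the \<open>\<mu>\<close> half is the \<open>\<lambda>\<close> half for \<open>- A\<close>.

  Upper bound. If \<open>M\<close> had \<open>i\<close> eigenvalues above \<open>r + L + L ln (r / L)\<close>, some \<open>y \<noteq> 0\<close> in their span
  would have \<open>S\<^sup>T y\<close> orthogonal to all eigenvectors of \<open>A\<close> with eigenvalue above \<open>r\<close>. Then \<open>y\<^sup>T M y\<close> is at
  most the sum of \<open>d\<^sub>j a\<^sub>j\<^sup>2\<close> over \<open>0 < d\<^sub>j \<le> r\<close>, where the \<open>a\<^sub>j\<close> are the coordinates of \<open>S\<^sup>T y\<close>. By duality the
  embedding property bounds the sum of \<open>a\<^sub>j\<^sup>2\<close> over \<open>d\<^sub>j \<ge> t\<close> by \<open>(1 + L / t) \<parallel>y\<parallel>\<^sup>2\<close>; integrating this over \<open>t\<close>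
  gives the logarithm.

  Lower bound. \<open>M\<close> has at least as many positive eigenvalues as \<open>A\<close>, so only \<open>r \<ge> 20 L\<close> matters. If
  fewer than \<open>i\<close> eigenvalues of \<open>M\<close> were at least \<open>\<tau> = r - 10 L\<close>, then some \<open>y \<noteq> 0\<close> spanned by eigenvectors
  with eigenvalue in \<open>(0, \<tau>)\<close> would have \<open>x = A S\<^sup>T y\<close> orthogonal to the eigenvectors of \<open>A\<close> with eigenvalue
  in \<open>(0, r)\<close>. Since \<open>S x = M y\<close>, this forces \<open>\<parallel>S x\<parallel>\<^sup>2 < \<tau> x\<^sup>T A\<^sup>+ x\<close>, with \<open>A\<^sup>+\<close> the pseudoinverse. Split
  \<open>x = u + w\<close> with \<open>u\<close> on \<open>\<bar>d\<^sub>j\<bar> \<ge> r\<close> and \<open>w\<close> on \<open>- r < d\<^sub>j < 0\<close>. The embedding property at every level makes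
  \<open>S u\<close> and \<open>S w\<close> so nearly orthogonal that the cross term is absorbed by the negative contribution of
  \<open>w\<close> to \<open>\<tau> x\<^sup>T A\<^sup>+ x\<close> and by the gap between \<open>r\<close> and \<open>\<tau>\<close>; this costs no logarithm.
\<close>

section \<open>Homogeneous systems and layer-cake summation\<close>

text \<open>Gaussian elimination, one equation at a time. It replaces all dimension counts for
  intersecting subspaces below. Since the solution vanishes off \<open>J\<close>, sums over
  \<open>J\<close> extend to the whole index range.\<close>

lemma homogeneous_system_nontrivial:
  fixes F :: "('a \<Rightarrow> real) set"
  assumes "finite F" "finite J" "card F < card J"
  shows "\<exists>x. (\<exists>j. x j \<noteq> 0) \<and> (\<forall>j. j \<notin> J \<longrightarrow> x j = 0) \<and> (\<forall>f\<in>F. (\<Sum>j\<in>J. f j * x j) = 0)"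
proof -
  have "\<exists>x. (\<exists>j. x j \<noteq> 0) \<and> (\<forall>j. j \<notin> J \<longrightarrow> x j = 0) \<and> (\<forall>i<m. (\<Sum>j\<in>J. c i j * x j) = 0)"
    if "finite J" "m < card J" for m J and c :: "nat \<Rightarrow> 'a \<Rightarrow> real"
    using that
  proof (induction m arbitrary: J c)
    case 0
    then obtain p where "p \<in> J" by fastforce
    then show ?case by (intro exI[of _ "\<lambda>j. if j = p then 1 else 0"]) auto
  next
    case (Suc m)
    show ?case
    proof (cases "\<forall>j\<in>J. c m j = 0")
      case True
      obtain x where "\<exists>j. x j \<noteq> 0" "\<forall>j. j \<notin> J \<longrightarrow> x j = 0" "\<forall>i<m. (\<Sum>j\<in>J. c i j * x j) = 0"
        using Suc.IH[of J c] Suc.prems by auto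
      then show ?thesis using True by (intro exI[of _ x]) (auto simp: less_Suc_eq)
    next
      case False
      then obtain p where p: "p \<in> J" "c m p \<noteq> 0" by auto
      define K where "K = J - {p}"
      have K: "finite K" "p \<notin> K" "J = insert p K" "m < card K"
        using Suc.prems p by (auto simp: K_def)
      obtain x where x: "\<exists>j. x j \<noteq> 0" "\<forall>j. j \<notin> K \<longrightarrow> x j = 0"
        "\<forall>i<m. (\<Sum>j\<in>K. (c i j - c i p * c m j / c m p) * x j) = 0"
        using Suc.IH[of K "\<lambda>i j. c i j - c i p * c m j / c m p"] K by auto
      \<comment> \<open>The value at the pivot \<open>p\<close> solves equation \<open>m\<close>;
        substituting it into the other equations produces the reduced coefficients that
        \<open>x\<close> satisfies.\<close>
      define y where "y = x(p := - (\<Sum>j\<in>K. c m j * x j) / c m p)"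
      have split: "(\<Sum>j\<in>J. c i j * y j) = c i p * y p + (\<Sum>j\<in>K. c i j * x j)" for i
      proof -
        have "(\<Sum>j\<in>K. c i j * y j) = (\<Sum>j\<in>K. c i j * x j)"
          using K by (intro sum.cong) (auto simp: y_def)
        then show ?thesis using K by simp
      qed
      have "(\<Sum>j\<in>J. c i j * y j) = 0" if "i < Suc m" for i
      proof (cases "i = m")
        case True
        then show ?thesis using split[of m] p by (simp add: y_def)
      next
        case False
        then have "(\<Sum>j\<in>K. (c i j - c i p * c m j / c m p) * x j) = 0" using that x by auto
        then have "(\<Sum>j\<in>K. c i j * x j) = (c i p / c m p) * (\<Sum>j\<in>K. c m j * x j)"
          by (simp add: left_diff_distrib sum_subtractf sum_distrib_left mult.assoc)
        then show ?thesis using split[of i] by (simp add: y_def)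
      qed
      moreover have "\<exists>j. y j \<noteq> 0" using x K by (metis fun_upd_other y_def)
      moreover have "\<forall>j. j \<notin> J \<longrightarrow> y j = 0" using x K by (auto simp: y_def)
      ultimately show ?thesis by blast
    qed
  qed
  note nat_indexed = this
  obtain h where h: "bij_betw h {0..<card F} F"
    using ex_bij_betw_nat_finite[OF assms(1)] by blast
  obtain x where x: "\<exists>j. x j \<noteq> 0" "\<forall>j. j \<notin> J \<longrightarrow> x j = 0"
    "\<forall>i<card F. (\<Sum>j\<in>J. h i j * x j) = 0"
    using nat_indexed[OF assms(2,3), of h] by blast
  have "(\<Sum>j\<in>J. f j * x j) = 0" if "f \<in> F" for f
    using that x(3) bij_betw_imp_surj_on[OF h] by force
  with x show ?thesis by blast
qed

text \<open>
  The discrete form of writing the sum of \<open>(d j - a) * g j\<close> as the integral of its tail sums;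
  \<open>prim\<close> lets \<open>\<Phi>\<close> play the role of a primitive of \<open>\<psi>\<close>.
\<close>

lemma layer_cake_bound:
  fixes d g :: "'a \<Rightarrow> real"
  assumes "finite J" "\<And>j. j \<in> J \<Longrightarrow> a \<le> d j" "\<And>j. j \<in> J \<Longrightarrow> d j \<le> m" "a \<le> m"
    and nonneg: "\<And>j. j \<in> J \<Longrightarrow> 0 \<le> g j"
    and tail: "\<And>t. a \<le> t \<Longrightarrow> t \<le> m \<Longrightarrow> (\<Sum>j | j \<in> J \<and> t \<le> d j. g j) \<le> \<psi> t"
    and prim: "\<And>s t. a \<le> s \<Longrightarrow> s \<le> t \<Longrightarrow> (t - s) * \<psi> t \<le> \<Phi> t - \<Phi> s"
  shows "(\<Sum>j\<in>J. (d j - a) * g j) \<le> \<Phi> m - \<Phi> a"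
  using assms
proof (induction "card J" arbitrary: J a rule: less_induct)
  case less
  note prems = less.prems
  show ?case
  proof (cases "J = {}")
    case True
    \<comment> \<open>The tail sum over the empty set is 0, so \<open>tail\<close> forces \<psi> to
      be nonnegative at \<open>m\<close>.\<close>
    have "0 \<le> \<psi> m" using prems(6)[of m] prems(4) True by simp
    then have "0 \<le> (m - a) * \<psi> m" using prems(4) by simp
    also have "\<dots> \<le> \<Phi> m - \<Phi> a" using prems(4) by (intro prems(7)) auto
    finally show ?thesis using True by simp
  next
    case False
    \<comment> \<open>Raising the base from \<open>a\<close> to the least value \<open>b\<close>
      costs \<open>b - a\<close> times the full sum of \<open>g\<close>, which the tail bound at
      \<open>b\<close> controls. The minimizer \<open>q\<close> then has weight 0 and drops
      out.\<close>
    define b where "b = Min (d ` J)"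
    have b_le: "b \<le> d j" if "j \<in> J" for j using that prems(1) by (simp add: b_def)
    have "b \<in> d ` J" unfolding b_def using False prems(1) by (intro Min_in) auto
    then obtain q where q: "q \<in> J" "d q = b" by auto
    define K where "K = J - {q}"
    have K: "finite K" "q \<notin> K" "J = insert q K" "K \<subseteq> J" using q prems(1) by (auto simp: K_def)
    have ab: "a \<le> b" "b \<le> m" using q prems(2,3) by auto
    have "card K < card J" using K by simp
    moreover have "(\<Sum>j | j \<in> K \<and> t \<le> d j. g j) \<le> \<psi> t" if "b \<le> t" "t \<le> m" for t
    proof -
      have "(\<Sum>j | j \<in> K \<and> t \<le> d j. g j) \<le> (\<Sum>j | j \<in> J \<and> t \<le> d j. g j)"
        using K prems(1,5) by (intro sum_mono2) auto
      then show ?thesis using prems(6)[of t] that ab by simp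
    qed
    moreover have "(t - s) * \<psi> t \<le> \<Phi> t - \<Phi> s" if "b \<le> s" "s \<le> t" for s t
      using prems(7) that ab by simp
    ultimately have IH: "(\<Sum>j\<in>K. (d j - b) * g j) \<le> \<Phi> m - \<Phi> b"
      using K(1,4) ab(2) b_le prems(3,5) by (intro less.hyps) (simp_all add: subset_iff)
    have "{j. j \<in> J \<and> b \<le> d j} = J" using b_le by auto
    then have "(\<Sum>j\<in>J. g j) \<le> \<psi> b" using prems(6)[of b] ab by simp
    then have "(b - a) * (\<Sum>j\<in>J. g j) \<le> (b - a) * \<psi> b" using ab by (intro mult_left_mono) auto
    also have "\<dots> \<le> \<Phi> b - \<Phi> a" using prems(7) ab by simp
    finally have "(b - a) * (\<Sum>j\<in>J. g j) \<le> \<Phi> b - \<Phi> a" .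
    moreover have "(\<Sum>j\<in>J. (d j - a) * g j) = (\<Sum>j\<in>J. (d j - b) * g j) + (b - a) * (\<Sum>j\<in>J. g j)"
      by (simp add: left_diff_distrib sum_subtractf sum_distrib_left)
    moreover have "(\<Sum>j\<in>J. (d j - b) * g j) = (\<Sum>j\<in>K. (d j - b) * g j)"
      using K q by simp
    ultimately show ?thesis using IH by linarith
  qed
qed

section \<open>Spectral bounds in eigenbasis coordinates\<close>

text \<open>
  Here \<open>d\<close> and \<open>e\<close> list the eigenvalues of \<open>A\<close> and \<open>M = S A S\<^sup>T\<close>, and \<open>b l j\<close> is the inner product
  of the \<open>l\<close>-th eigenvector of \<open>M\<close> with the image under \<open>S\<close> of the \<open>j\<close>-th eigenvector of \<open>A\<close>. So
  \<open>sketch\<close> is \<open>S\<close> in the two eigenbases, and \<open>diagonal\<close> says that \<open>M\<close> is diagonal in its own.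
\<close>

locale sketched_spectrum =
  fixes n k :: nat and d e :: "nat \<Rightarrow> real" and b :: "nat \<Rightarrow> nat \<Rightarrow> real" and L :: real
  assumes L_pos: "0 < L"
    and diagonal: "\<And>l l'. l < k \<Longrightarrow> l' < k \<Longrightarrow>
      (\<Sum>j<n. b l j * d j * b l' j) = (if l = l' then e l else 0)"
    and gap: "\<And>j. j < n \<Longrightarrow> d j = 0 \<or> L \<le> \<bar>d j\<bar>"
    and embed: "\<And>t x. L \<le> t \<Longrightarrow> (\<And>j. j < n \<Longrightarrow> x j \<noteq> 0 \<Longrightarrow> t \<le> \<bar>d j\<bar>) \<Longrightarrow>
      \<bar>(\<Sum>l<k. (\<Sum>j<n. b l j * x j)\<^sup>2) - (\<Sum>j<n. (x j)\<^sup>2)\<bar> \<le> min (L / t) (1/10) * (\<Sum>j<n. (x j)\<^sup>2)"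
begin

definition sketch :: "(nat \<Rightarrow> real) \<Rightarrow> nat \<Rightarrow> real" where
  "sketch x l = (\<Sum>j<n. b l j * x j)"

definition sketch_adj :: "(nat \<Rightarrow> real) \<Rightarrow> nat \<Rightarrow> real" where
  "sketch_adj y j = (\<Sum>l<k. b l j * y l)"

lemma adjoint: "(\<Sum>l<k. sketch x l * y l) = (\<Sum>j<n. x j * sketch_adj y j)"
  unfolding sketch_def sketch_adj_def sum_distrib_left sum_distrib_right
  by (subst sum.swap) (simp add: mult_ac)

text \<open>Coordinate form of \<open>M y = S (A S\<^sup>T y)\<close>.\<close>

lemma sketch_scaled_adj:
  assumes "l < k"
  shows "sketch (\<lambda>j. d j * sketch_adj y j) l = e l * y l"
proof -
  have "sketch (\<lambda>j. d j * sketch_adj y j) l = (\<Sum>j<n. \<Sum>m<k. b l j * d j * b m j * y m)"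
    by (simp add: sketch_def sketch_adj_def sum_distrib_left mult_ac)
  also have "\<dots> = (\<Sum>m<k. (\<Sum>j<n. b l j * d j * b m j) * y m)"
    by (subst sum.swap) (simp add: sum_distrib_right)
  also have "\<dots> = (\<Sum>m<k. if m = l then e l * y l else 0)"
    using assms by (intro sum.cong) (auto simp: diagonal)
  finally show ?thesis using assms by simp
qed

lemma quadratic_form: "(\<Sum>l<k. e l * (y l)\<^sup>2) = (\<Sum>j<n. d j * (sketch_adj y j)\<^sup>2)"
proof -
  have "(\<Sum>l<k. e l * (y l)\<^sup>2) = (\<Sum>l<k. sketch (\<lambda>j. d j * sketch_adj y j) l * y l)"
    by (intro sum.cong) (auto simp: sketch_scaled_adj power2_eq_square)
  then show ?thesis unfolding adjoint by (simp add: power2_eq_square mult_ac)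
qed

text \<open>The two arguments of the minimum serve different ends: \<open>L / t\<close> makes the
  distortion decay with the level, while 1/10 keeps \<open>sketch\<close> injective even at
  \<open>t = L\<close>.\<close>

lemma embed_sketch:
  assumes "L \<le> t" "\<And>j. j < n \<Longrightarrow> x j \<noteq> 0 \<Longrightarrow> t \<le> \<bar>d j\<bar>"
  shows "\<bar>(\<Sum>l<k. (sketch x l)\<^sup>2) - (\<Sum>j<n. (x j)\<^sup>2)\<bar> \<le> L / t * (\<Sum>j<n. (x j)\<^sup>2)"
    and "9/10 * (\<Sum>j<n. (x j)\<^sup>2) \<le> (\<Sum>l<k. (sketch x l)\<^sup>2)"
proof -
  have *: "\<bar>(\<Sum>l<k. (sketch x l)\<^sup>2) - (\<Sum>j<n. (x j)\<^sup>2)\<bar> \<le> min (L / t) (1/10) * (\<Sum>j<n. (x j)\<^sup>2)"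
    unfolding sketch_def using embed[OF assms] by simp
  have nn: "0 \<le> (\<Sum>j<n. (x j)\<^sup>2)" by (simp add: sum_nonneg)
  have "min (L / t) (1/10) * (\<Sum>j<n. (x j)\<^sup>2) \<le> L / t * (\<Sum>j<n. (x j)\<^sup>2)"
    using nn by (intro mult_right_mono) auto
  with * show "\<bar>(\<Sum>l<k. (sketch x l)\<^sup>2) - (\<Sum>j<n. (x j)\<^sup>2)\<bar> \<le> L / t * (\<Sum>j<n. (x j)\<^sup>2)" by linarith
  have "min (L / t) (1/10) \<le> 1/10" by (rule min.cobounded2)
  from mult_right_mono[OF this nn]
  have "min (L / t) (1/10) * (\<Sum>j<n. (x j)\<^sup>2) \<le> 1/10 * (\<Sum>j<n. (x j)\<^sup>2)" .
  with * show "9/10 * (\<Sum>j<n. (x j)\<^sup>2) \<le> (\<Sum>l<k. (sketch x l)\<^sup>2)" by linarith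
qed

text \<open>Polarization: by orthogonality \<open>s x + z\<close> and \<open>- s x + z\<close> have
  the same squared norm, so the embedding bounds the difference of their sketched norms. The free
  \<open>s\<close> lets a caller balance vectors of different size.\<close>

lemma near_orthogonal:
  assumes t: "L \<le> t" and supp: "\<And>j. j < n \<Longrightarrow> x j \<noteq> 0 \<or> z j \<noteq> 0 \<Longrightarrow> t \<le> \<bar>d j\<bar>"
    and orth: "(\<Sum>j<n. x j * z j) = 0"
  shows "2 * s * (\<Sum>l<k. sketch x l * sketch z l) \<le> L / t * (s\<^sup>2 * (\<Sum>j<n. (x j)\<^sup>2) + (\<Sum>j<n. (z j)\<^sup>2))"
proof -
  define N where "N = s\<^sup>2 * (\<Sum>j<n. (x j)\<^sup>2) + (\<Sum>j<n. (z j)\<^sup>2)"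
  have sketch_linear: "sketch (\<lambda>j. r * x j + z j) l = r * sketch x l + sketch z l" for r l
    by (simp add: sketch_def distrib_left sum.distrib sum_distrib_left mult_ac)
  have sq: "(\<Sum>j<m. (r * f j + g j)\<^sup>2) = r\<^sup>2 * (\<Sum>j<m. (f j)\<^sup>2) + 2 * r * (\<Sum>j<m. f j * g j) + (\<Sum>j<m. (g j)\<^sup>2)"
    for r :: real and f g :: "nat \<Rightarrow> real" and m :: nat
    by (simp add: power2_sum power_mult_distrib sum.distrib sum_distrib_left mult_ac)
  have *: "\<bar>(\<Sum>l<k. (sketch (\<lambda>j. r * x j + z j) l)\<^sup>2) - N\<bar> \<le> L / t * N" if "r\<^sup>2 = s\<^sup>2" for r
  proof -
    have "(\<Sum>j<n. (r * x j + z j)\<^sup>2) = N" using orth that by (simp add: sq N_def)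
    then show ?thesis using embed_sketch(1)[of t "\<lambda>j. r * x j + z j"] t supp by fastforce
  qed
  from *[of s] *[of "- s"] show ?thesis
    unfolding sketch_linear sq N_def[symmetric] by (simp add: algebra_simps abs_le_iff)
qed

text \<open>Otherwise counting equations gives a nonzero \<open>x\<close> on the nonzero eigenvalues
  of \<open>A\<close> such that \<open>y = S x\<close> has no component on positive eigenvalues of
  \<open>M\<close> and \<open>S\<^sup>T y\<close> none on negative eigenvalues of \<open>A\<close>.
  Then \<open>y\<^sup>T M y\<close> is both at most and at least 0, which forces
  \<open>S x = 0\<close>, against injectivity at level \<open>L\<close>.\<close>

lemma card_positive_le: "card {j. j < n \<and> 0 < d j} \<le> card {l. l < k \<and> 0 < e l}"
proof (rule ccontr)
  assume "\<not> ?thesis"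
  then have less: "card {l. l < k \<and> 0 < e l} < card {j. j < n \<and> 0 < d j}" by simp
  define J where "J = {j. j < n \<and> d j \<noteq> 0}"
  \<comment> \<open>Both families are conditions on \<open>x\<close>:
    \<open>sketch_adj (\<lambda>l. b l j) m\<close> is the \<open>(m, j)\<close> entry of
    \<open>S\<^sup>T S\<close> in the eigenbasis of \<open>A\<close>.\<close>
  define F where "F = (\<lambda>l. b l) ` {l. l < k \<and> 0 < e l} \<union> (\<lambda>m j. sketch_adj (\<lambda>l. b l j) m) ` {m. m < n \<and> d m < 0}"
  have "J = {j. j < n \<and> 0 < d j} \<union> {m. m < n \<and> d m < 0}" by (auto simp: J_def)
  then have "card J = card {j. j < n \<and> 0 < d j} + card {m. m < n \<and> d m < 0}"
    by (simp add: card_Un_disjoint disjoint_iff)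
  moreover have "card F \<le> card {l. l < k \<and> 0 < e l} + card {m. m < n \<and> d m < 0}"
    unfolding F_def by (intro order.trans[OF card_Un_le] add_mono card_image_le) auto
  ultimately have "card F < card J" using less by linarith
  moreover have "finite F" "finite J" by (auto simp: F_def J_def)
  ultimately obtain x where x: "\<exists>j. x j \<noteq> 0" "\<And>j. j \<notin> J \<Longrightarrow> x j = 0"
    and eqs: "\<And>f. f \<in> F \<Longrightarrow> (\<Sum>j\<in>J. f j * x j) = 0"
    using homogeneous_system_nontrivial[of F J] by blast
  have sumJ: "(\<Sum>j\<in>J. f j * x j) = (\<Sum>j<n. f j * x j)" for f
    using x(2) by (intro sum.mono_neutral_left) (auto simp: J_def)
  define y where "y = sketch x"
  have y0: "y l = 0" if "l < k" "0 < e l" for l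
    using eqs[of "b l"] that by (auto simp: F_def sumJ y_def sketch_def)
  have T0: "sketch_adj y m = 0" if "m < n" "d m < 0" for m
  proof -
    have "sketch_adj y m = (\<Sum>j<n. sketch_adj (\<lambda>l. b l j) m * x j)"
      unfolding sketch_adj_def y_def sketch_def sum_distrib_left sum_distrib_right
      by (subst sum.swap) (simp add: mult_ac)
    then show ?thesis using eqs[of "\<lambda>j. sketch_adj (\<lambda>l. b l j) m"] that by (auto simp: F_def sumJ)
  qed
  have "(\<Sum>l<k. e l * (y l)\<^sup>2) \<le> 0"
    using y0 by (intro sum_nonpos) (force simp: mult_le_0_iff not_less)
  moreover have nn: "0 \<le> d j * (sketch_adj y j)\<^sup>2" if "j < n" for j
    using T0[of j] that by (cases "d j < 0") auto
  ultimately have "(\<Sum>j<n. d j * (sketch_adj y j)\<^sup>2) = 0"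
    unfolding quadratic_form by (intro antisym sum_nonneg) auto
  then have "d j * (sketch_adj y j)\<^sup>2 = 0" if "j < n" for j
    using nn that by (subst (asm) sum_nonneg_eq_0_iff) auto
  then have "x j * sketch_adj y j = 0" if "j < n" for j
    using x(2)[of j] that by (fastforce simp: J_def)
  then have "(\<Sum>j<n. x j * sketch_adj y j) = 0" by (intro sum.neutral) auto
  then have "(\<Sum>l<k. (sketch x l)\<^sup>2) = 0"
    using adjoint[of x y] by (simp add: y_def power2_eq_square)
  moreover have "9/10 * (\<Sum>j<n. (x j)\<^sup>2) \<le> (\<Sum>l<k. (sketch x l)\<^sup>2)"
    using x(2) gap by (intro embed_sketch(2)[of L]) (auto simp: J_def)
  moreover have "0 < (\<Sum>j<n. (x j)\<^sup>2)"
  proof -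
    obtain q where "x q \<noteq> 0" using x(1) by blast
    with x(2) have "q < n" by (auto simp: J_def)
    then show ?thesis using \<open>x q \<noteq> 0\<close> by (intro sum_pos2[of _ q]) auto
  qed
  ultimately show False by linarith
qed

text \<open>Working with counts on both sides avoids ordering either spectrum; the
  \<open>i\<close>-th eigenvalue enters only after the transfer to matrices.\<close>

lemma card_upper_le:
  assumes r: "L \<le> r"
  shows "card {l. l < k \<and> r + L + L * ln (r / L) < e l} \<le> card {j. j < n \<and> r < d j}"
proof (rule ccontr)
  \<comment> \<open>The integral of \<open>1 + L / t\<close> over \<open>[L, r]\<close> is
    \<open>r - L + L * ln (r / L)\<close>; the layer below \<open>L\<close> adds
    \<open>2 * L\<close>.\<close>
  define \<tau> where "\<tau> = r + L + L * ln (r / L)"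
  have \<tau>_pos: "0 < \<tau>" using r L_pos by (simp add: \<tau>_def add_pos_nonneg)
  assume "\<not> ?thesis"
  then have less: "card {j. j < n \<and> r < d j} < card {l. l < k \<and> \<tau> < e l}" by (simp add: \<tau>_def)
  define J where "J = {l. l < k \<and> \<tau> < e l}"
  define F where "F = (\<lambda>j l. b l j) ` {j. j < n \<and> r < d j}"
  have "card F \<le> card {j. j < n \<and> r < d j}" unfolding F_def by (intro card_image_le) auto
  then have "card F < card J" using less by (simp add: J_def)
  moreover have "finite F" "finite J" by (auto simp: F_def J_def)
  ultimately obtain y where y: "\<exists>j. y j \<noteq> 0" "\<And>j. j \<notin> J \<Longrightarrow> y j = 0"
    and eqs: "\<And>f. f \<in> F \<Longrightarrow> (\<Sum>j\<in>J. f j * y j) = 0"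
    using homogeneous_system_nontrivial[of F J] by blast
  have sumJ: "(\<Sum>l\<in>J. f l * y l) = (\<Sum>l<k. f l * y l)" for f
    using y(2) by (intro sum.mono_neutral_left) (auto simp: J_def)
  have T0: "sketch_adj y j = 0" if "j < n" "r < d j" for j
    using eqs[of "\<lambda>l. b l j"] that by (auto simp: F_def sumJ sketch_adj_def)
  define Y where "Y = (\<Sum>l<k. (y l)\<^sup>2)"
  obtain q where q: "y q \<noteq> 0" using y(1) by blast
  then have "q \<in> J" using y(2) by blast
  have "\<tau> * Y < (\<Sum>l<k. e l * (y l)\<^sup>2)"
    unfolding Y_def sum_distrib_left
  proof (rule sum_strict_mono_ex1)
    show "\<forall>l\<in>{..<k}. \<tau> * (y l)\<^sup>2 \<le> e l * (y l)\<^sup>2"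
    proof
      fix l
      show "\<tau> * (y l)\<^sup>2 \<le> e l * (y l)\<^sup>2"
        using y(2)[of l] by (cases "l \<in> J") (auto simp: J_def intro!: mult_right_mono)
    qed
    show "\<exists>l\<in>{..<k}. \<tau> * (y l)\<^sup>2 < e l * (y l)\<^sup>2"
      using q \<open>q \<in> J\<close> by (intro bexI[of _ q]) (auto simp: J_def)
  qed simp
  also have "\<dots> = (\<Sum>j<n. d j * (sketch_adj y j)\<^sup>2)" by (rule quadratic_form)
  also have "\<dots> \<le> (\<Sum>j | j < n \<and> 0 < d j \<and> d j \<le> r. d j * (sketch_adj y j)\<^sup>2)"
  proof -
    \<comment> \<open>Negative eigenvalues contribute at most 0, and those above \<open>r\<close>
      contribute nothing by \<open>T0\<close>.\<close>
    have "(\<Sum>j<n. d j * (sketch_adj y j)\<^sup>2) \<le> (\<Sum>j<n. if 0 < d j \<and> d j \<le> r then d j * (sketch_adj y j)\<^sup>2 else 0)"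
      using T0 by (intro sum_mono) (force simp: mult_le_0_iff not_less)
    also have "\<dots> = (\<Sum>j | j < n \<and> 0 < d j \<and> d j \<le> r. d j * (sketch_adj y j)\<^sup>2)"
      by (subst sum.inter_filter[symmetric]) auto
    finally show ?thesis .
  qed
  finally have less_sum: "\<tau> * Y < (\<Sum>j | j < n \<and> 0 < d j \<and> d j \<le> r. d j * (sketch_adj y j)\<^sup>2)" .
  define P where "P = {j. j < n \<and> 0 < d j \<and> d j \<le> r}"
  \<comment> \<open>Duality: \<open>U\<close> is the inner product of \<open>sketch u\<close> with
    \<open>y\<close>. The arithmetic-geometric mean inequality with weight
    \<open>s = 1 + L / t\<close> gives \<open>2 s U \<le> s U + s^2 Y\<close>, hence
    \<open>U \<le> s Y\<close>.\<close>
  have tail: "(\<Sum>j | j \<in> P \<and> t \<le> d j. (sketch_adj y j)\<^sup>2) \<le> (1 + L / t) * Y" if t: "L \<le> t" for t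
  proof -
    define u where "u j = (if j \<in> P \<and> t \<le> d j then sketch_adj y j else 0)" for j
    define U where "U = (\<Sum>j<n. (u j)\<^sup>2)"
    define s where "s = 1 + L / t"
    have s: "0 < s" using L_pos t by (simp add: s_def add_pos_nonneg)
    have U_eq: "U = (\<Sum>j | j \<in> P \<and> t \<le> d j. (sketch_adj y j)\<^sup>2)"
      unfolding U_def by (rule sum.mono_neutral_cong_right) (auto simp: u_def P_def)
    have "\<bar>(\<Sum>l<k. (sketch u l)\<^sup>2) - U\<bar> \<le> L / t * U"
      unfolding U_def by (rule embed_sketch(1)[OF t]) (auto simp: u_def split: if_splits)
    then have SU: "(\<Sum>l<k. (sketch u l)\<^sup>2) \<le> s * U" by (simp add: s_def algebra_simps)
    have "U = (\<Sum>l<k. sketch u l * y l)"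
      unfolding adjoint U_def by (intro sum.cong) (auto simp: u_def power2_eq_square)
    then have "2 * s * U = (\<Sum>l<k. 2 * s * (sketch u l * y l))" by (simp add: sum_distrib_left)
    also have "\<dots> \<le> (\<Sum>l<k. (sketch u l)\<^sup>2 + s\<^sup>2 * (y l)\<^sup>2)"
    proof (rule sum_mono)
      fix l
      show "2 * s * (sketch u l * y l) \<le> (sketch u l)\<^sup>2 + s\<^sup>2 * (y l)\<^sup>2"
        using sum_squares_bound[of "sketch u l" "s * y l"] by (simp add: power_mult_distrib algebra_simps)
    qed
    also have "\<dots> \<le> s * U + s\<^sup>2 * Y"
      using SU by (simp add: sum.distrib sum_distrib_left Y_def)
    finally have "s * U \<le> s * (s * Y)" by (simp add: power2_eq_square mult_ac)
    then show ?thesis using s U_eq by (simp add: s_def)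
  qed
  have "finite P" by (simp add: P_def)
  have LP: "L \<le> d j" if "j \<in> P" for j using gap[of j] that by (auto simp: P_def)
  define \<Phi> where "\<Phi> t = (t + L * ln t) * Y" for t
  have Y0: "0 \<le> Y" by (simp add: Y_def sum_nonneg)
  have "(\<Sum>j\<in>P. (d j - L) * (sketch_adj y j)\<^sup>2) \<le> \<Phi> r - \<Phi> L"
  proof (rule layer_cake_bound[where \<psi> = "\<lambda>t. (1 + L / t) * Y"])
    fix s t assume st: "L \<le> s" "s \<le> t"
    then have pos: "0 < s" "0 < t" using L_pos by auto
    \<comment> \<open>This bounds the increment of the logarithm below by \<open>1 - s / t\<close>,
      so that \<Phi> grows as fast as \<open>prim\<close> requires.\<close>
    have "ln (s / t) \<le> s / t - 1" using pos by (intro ln_le_minus_one) auto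
    then have "1 - s / t \<le> ln t - ln s" using pos by (simp add: ln_div)
    then have "L * (1 - s / t) \<le> L * (ln t - ln s)" using L_pos by (intro mult_left_mono) auto
    then have "(t - s) * (1 + L / t) \<le> (t + L * ln t) - (s + L * ln s)"
      using pos by (simp add: field_simps)
    then have "(t - s) * (1 + L / t) * Y \<le> ((t + L * ln t) - (s + L * ln s)) * Y"
      using Y0 by (intro mult_right_mono)
    then show "(t - s) * ((1 + L / t) * Y) \<le> \<Phi> t - \<Phi> s" by (simp add: \<Phi>_def algebra_simps)
  qed (use \<open>finite P\<close> LP tail r in \<open>auto simp: P_def\<close>)
  \<comment> \<open>No eigenvalue in \<open>P\<close> lies below \<open>L\<close>, so the bottom
    layer carries the full sum; the tail factor at \<open>t = L\<close> is 2.\<close>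
  moreover have "L * (\<Sum>j\<in>P. (sketch_adj y j)\<^sup>2) \<le> L * (2 * Y)"
  proof -
    have "{j. j \<in> P \<and> L \<le> d j} = P" using LP by auto
    then show ?thesis using tail[of L] L_pos by simp
  qed
  moreover have "(\<Sum>j\<in>P. d j * (sketch_adj y j)\<^sup>2) = (\<Sum>j\<in>P. (d j - L) * (sketch_adj y j)\<^sup>2) + L * (\<Sum>j\<in>P. (sketch_adj y j)\<^sup>2)"
    by (simp add: left_diff_distrib sum_subtractf sum_distrib_left)
  moreover have "\<Phi> r - \<Phi> L + L * (2 * Y) = \<tau> * Y"
    using r L_pos by (simp add: \<Phi>_def \<tau>_def ln_div algebra_simps)
  ultimately have "(\<Sum>j\<in>P. d j * (sketch_adj y j)\<^sup>2) \<le> \<tau> * Y" by linarith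
  then show False using less_sum by (simp add: P_def)
qed

lemma card_lower_ge:
  assumes r: "20 * L \<le> r"
  shows "card {j. j < n \<and> r \<le> d j} \<le> card {l. l < k \<and> r - 10 * L \<le> e l}"
proof (rule ccontr)
  \<comment> \<open>Of the gap \<open>10 * L\<close>, one \<open>L\<close> pays for the distortion
    of \<open>u\<close> and \<open>8 * L\<close> for the cross term. With
    \<open>20 * L \<le> r\<close> it leaves \<open>r \<le> 2 * \<tau>\<close>, which trades
    \<open>1 / \<tau>\<close> for \<open>2 / r\<close>.\<close>
  define \<tau> where "\<tau> = r - 10 * L"
  have \<tau>: "0 < \<tau>" "r \<le> 2 * \<tau>" "0 < r" "L \<le> r" using r L_pos by (auto simp: \<tau>_def)
  assume "\<not> ?thesis"
  then have less: "card {l. l < k \<and> \<tau> \<le> e l} < card {j. j < n \<and> r \<le> d j}" by (simp add: \<tau>_def)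
  define J where "J = {l. l < k \<and> 0 < e l \<and> e l < \<tau>}"
  define F where "F = (\<lambda>j l. b l j) ` {j. j < n \<and> 0 < d j \<and> d j < r}"
  have "{l. l < k \<and> 0 < e l} = J \<union> {l. l < k \<and> \<tau> \<le> e l}" using \<tau> by (auto simp: J_def)
  then have "card {l. l < k \<and> 0 < e l} = card J + card {l. l < k \<and> \<tau> \<le> e l}"
    by (simp add: card_Un_disjoint disjoint_iff J_def not_le)
  moreover have "{j. j < n \<and> 0 < d j} = {j. j < n \<and> 0 < d j \<and> d j < r} \<union> {j. j < n \<and> r \<le> d j}"
    using \<tau> by auto
  then have "card {j. j < n \<and> 0 < d j} = card {j. j < n \<and> 0 < d j \<and> d j < r} + card {j. j < n \<and> r \<le> d j}"
    by (simp add: card_Un_disjoint disjoint_iff not_le)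
  moreover have "card F \<le> card {j. j < n \<and> 0 < d j \<and> d j < r}"
    unfolding F_def by (intro card_image_le) auto
  \<comment> \<open>\<open>M\<close> has at least as many positive eigenvalues as \<open>A\<close>,
    but fewer of them reach \<tau> than eigenvalues of \<open>A\<close> reach \<open>r\<close>; so
    the unknowns in \<open>J\<close> outnumber the equations.\<close>
  ultimately have "card F < card J" using less card_positive_le by linarith
  moreover have "finite F" "finite J" by (auto simp: F_def J_def)
  ultimately obtain y where y: "\<exists>j. y j \<noteq> 0" "\<And>j. j \<notin> J \<Longrightarrow> y j = 0"
    and eqs: "\<And>f. f \<in> F \<Longrightarrow> (\<Sum>j\<in>J. f j * y j) = 0"
    using homogeneous_system_nontrivial[of F J] by blast
  have sumJ: "(\<Sum>l\<in>J. f l * y l) = (\<Sum>l<k. f l * y l)" for f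
    using y(2) by (intro sum.mono_neutral_left) (auto simp: J_def)
  have T0: "sketch_adj y j = 0" if "j < n" "0 < d j" "d j < r" for j
    using eqs[of "\<lambda>l. b l j"] that by (auto simp: F_def sumJ sketch_adj_def)
  define x where "x j = d j * sketch_adj y j" for j
  define N where "N = {j. j < n \<and> - r < d j \<and> d j < 0}"
  define u where "u j = (if r \<le> \<bar>d j\<bar> then x j else 0)" for j
  define w where "w j = (if j \<in> N then x j else 0)" for j
  define U where "U = (\<Sum>j<n. (u j)\<^sup>2)"
  \<comment> \<open>\<open>W\<close> is the sum of \<open>(w j)^2 / \<bar>d j\<bar>\<close>, since
    \<open>w\<close> carries the factor \<open>d j\<close>; its negative is the share of
    \<open>w\<close> in \<open>x\<^sup>T A\<^sup>+ x\<close>.\<close>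
  define W where "W = (\<Sum>j\<in>N. \<bar>d j\<bar> * (sketch_adj y j)\<^sup>2)"
  have "finite N" by (simp add: N_def)
  have U0: "0 \<le> U" and W0: "0 \<le> W" by (auto simp: U_def W_def intro!: sum_nonneg)
  have x_split: "x j = u j + w j" if "j < n" for j
  proof -
    have "x j = 0 \<or> r \<le> \<bar>d j\<bar> \<or> j \<in> N" using T0[OF that] that
      by (cases "0 < d j") (auto simp: x_def N_def)
    moreover have "\<not> (r \<le> \<bar>d j\<bar> \<and> j \<in> N)" by (auto simp: N_def)
    ultimately show ?thesis by (auto simp: u_def w_def)
  qed
  obtain q where q: "y q \<noteq> 0" using y(1) by blast
  then have "q \<in> J" using y(2) by blast
  have "(\<Sum>l<k. (sketch x l)\<^sup>2) = (\<Sum>l<k. e l * e l * (y l)\<^sup>2)"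
    unfolding x_def by (intro sum.cong) (auto simp: sketch_scaled_adj power2_eq_square)
  \<comment> \<open>On the support of \<open>y\<close> the eigenvalues lie strictly between 0 and
    \<tau>, so squaring them gains less than a factor \<tau>.\<close>
  also have "\<dots> < (\<Sum>l<k. \<tau> * (e l * (y l)\<^sup>2))"
  proof (rule sum_strict_mono_ex1)
    show "\<forall>l\<in>{..<k}. e l * e l * (y l)\<^sup>2 \<le> \<tau> * (e l * (y l)\<^sup>2)"
    proof
      fix l
      show "e l * e l * (y l)\<^sup>2 \<le> \<tau> * (e l * (y l)\<^sup>2)"
        using y(2)[of l] by (cases "l \<in> J") (auto simp: J_def mult.assoc intro!: mult_right_mono)
    qed
    show "\<exists>l\<in>{..<k}. e l * e l * (y l)\<^sup>2 < \<tau> * (e l * (y l)\<^sup>2)"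
      using q \<open>q \<in> J\<close> by (intro bexI[of _ q]) (auto simp: J_def mult.assoc)
  qed simp
  also have "\<dots> = \<tau> * (\<Sum>j<n. d j * (sketch_adj y j)\<^sup>2)"
    by (simp only: sum_distrib_left[symmetric] quadratic_form)
  also have "\<dots> \<le> \<tau> * (U / r - W)"
  proof -
    \<comment> \<open>Where \<open>r \<le> \<bar>d j\<bar>\<close>,
      \<open>r * d j \<le> (d j)^2\<close> holds for either sign of \<open>d j\<close>; indices in
      \<open>N\<close> contribute exactly their share of \<open>- W\<close>.\<close>
    have "(\<Sum>j<n. d j * (sketch_adj y j)\<^sup>2)
        \<le> (\<Sum>j<n. (u j)\<^sup>2 / r - (if j \<in> N then \<bar>d j\<bar> * (sketch_adj y j)\<^sup>2 else 0))"
    proof (rule sum_mono)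
      fix j assume "j \<in> {..<n}"
      then have j: "j < n" by simp
      show "d j * (sketch_adj y j)\<^sup>2 \<le> (u j)\<^sup>2 / r - (if j \<in> N then \<bar>d j\<bar> * (sketch_adj y j)\<^sup>2 else 0)"
      proof (cases "r \<le> \<bar>d j\<bar>")
        case True
        have "r * d j \<le> \<bar>d j\<bar> * \<bar>d j\<bar>"
        proof -
          have "r * d j \<le> r * \<bar>d j\<bar>" using \<tau> by (intro mult_left_mono) auto
          also have "\<dots> \<le> \<bar>d j\<bar> * \<bar>d j\<bar>" using True by (intro mult_right_mono) auto
          finally show ?thesis .
        qed
        then have "r * d j * (sketch_adj y j)\<^sup>2 \<le> (d j)\<^sup>2 * (sketch_adj y j)\<^sup>2"
          by (intro mult_right_mono) (auto simp: power2_eq_square)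
        then show ?thesis
          using True \<tau> by (auto simp: u_def x_def N_def field_simps power_mult_distrib)
      next
        case False
        then have "sketch_adj y j = 0 \<or> d j = 0 \<or> j \<in> N" using T0[of j] j by (force simp: N_def)
        then show ?thesis using False by (auto simp: u_def N_def)
      qed
    qed
    also have "\<dots> = U / r - W"
    proof -
      have "(\<Sum>j<n. if j \<in> N then \<bar>d j\<bar> * (sketch_adj y j)\<^sup>2 else 0) = W"
        unfolding W_def by (rule sum.mono_neutral_cong_right) (auto simp: N_def)
      then show ?thesis by (simp add: sum_subtractf U_def sum_divide_distrib)
    qed
    finally show ?thesis using \<tau> by (intro mult_left_mono) auto
  qed
  finally have upper: "(\<Sum>l<k. (sketch x l)\<^sup>2) < \<tau> * (U / r - W)" .

  \<comment> \<open>\<open>f\<close> represents \<open>S\<^sup>T S u\<close>; its part on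
    \<open>N\<close> measures how far \<open>S u\<close> is from orthogonal to the sketches of
    vectors on \<open>N\<close>.\<close>
  define f where "f = sketch_adj (sketch u)"
  \<comment> \<open>Testing against \<open>z\<close>, the tail of \<open>f\<close> itself, makes the
    inner product of the two sketches equal to \<open>Z\<close>. Then \<open>near_orthogonal\<close>
    with \<open>s = L / t\<close> yields \<open>2 Z \<le> (L / t)^2 U + Z\<close>.\<close>
  have tail: "(\<Sum>j | j \<in> N \<and> t \<le> \<bar>d j\<bar>. (f j)\<^sup>2) \<le> (L / t)\<^sup>2 * U" if t: "L \<le> t" "t \<le> r" for t
  proof -
    define z where "z j = (if j \<in> N \<and> t \<le> \<bar>d j\<bar> then f j else 0)" for j
    define Z where "Z = (\<Sum>j<n. (z j)\<^sup>2)"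
    have t0: "0 < t" using t L_pos by linarith
    have Z_eq: "Z = (\<Sum>j | j \<in> N \<and> t \<le> \<bar>d j\<bar>. (f j)\<^sup>2)"
      unfolding Z_def by (rule sum.mono_neutral_cong_right) (auto simp: z_def N_def)
    have "(\<Sum>l<k. sketch u l * sketch z l) = Z"
    proof -
      have "(\<Sum>l<k. sketch u l * sketch z l) = (\<Sum>l<k. sketch z l * sketch u l)" by (simp add: mult.commute)
      also have "\<dots> = Z"
        unfolding adjoint Z_def f_def[symmetric] by (intro sum.cong) (auto simp: z_def power2_eq_square)
      finally show ?thesis .
    qed
    moreover have "2 * (L / t) * (\<Sum>l<k. sketch u l * sketch z l) \<le> L / t * ((L / t)\<^sup>2 * (\<Sum>j<n. (u j)\<^sup>2) + (\<Sum>j<n. (z j)\<^sup>2))"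
    proof (rule near_orthogonal[OF t(1)])
      show "(\<Sum>j<n. u j * z j) = 0" by (intro sum.neutral) (auto simp: u_def z_def N_def)
    qed (use t in \<open>auto simp: u_def z_def split: if_splits\<close>)
    ultimately have "L / t * (2 * Z) \<le> L / t * ((L / t)\<^sup>2 * U + Z)"
      by (simp add: U_def Z_def mult_ac)
    then have "2 * Z \<le> (L / t)\<^sup>2 * U + Z"
      by (rule mult_left_le_imp_le) (use L_pos t0 in simp)
    then show ?thesis using Z_eq by linarith
  qed
  have LN: "L \<le> \<bar>d j\<bar>" if "j \<in> N" for j using gap[of j] that by (auto simp: N_def)
  \<comment> \<open>The tail bound decays like \<open>1 / t^2\<close>, so its integral stays below
    \<open>L * U\<close> and no logarithm appears. The layer below \<open>L\<close> adds another
    \<open>L * U\<close>.\<close>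
  have f_sum: "(\<Sum>j\<in>N. \<bar>d j\<bar> * (f j)\<^sup>2) \<le> 2 * L * U"
  proof -
    define \<Phi> where "\<Phi> t = - (L\<^sup>2 / t * U)" for t
    have "(\<Sum>j\<in>N. (\<bar>d j\<bar> - L) * (f j)\<^sup>2) \<le> \<Phi> r - \<Phi> L"
    proof (rule layer_cake_bound[where \<psi> = "\<lambda>t. (L / t)\<^sup>2 * U"])
      fix s t assume st: "L \<le> s" "s \<le> t"
      then have pos: "0 < s" "0 < t" using L_pos by auto
      have "(t - s) * (L / t)\<^sup>2 \<le> (t - s) * (L\<^sup>2 / (s * t))"
        using st pos by (intro mult_left_mono) (auto simp: power2_eq_square frac_le)
      also have "\<dots> = L\<^sup>2 / s - L\<^sup>2 / t" using pos by (simp add: field_simps)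
      finally have "(t - s) * (L / t)\<^sup>2 * U \<le> (L\<^sup>2 / s - L\<^sup>2 / t) * U"
        using U0 by (rule mult_right_mono)
      then show "(t - s) * ((L / t)\<^sup>2 * U) \<le> \<Phi> t - \<Phi> s" by (simp add: \<Phi>_def algebra_simps)
    qed (use \<open>finite N\<close> LN tail \<tau> in \<open>auto simp: N_def\<close>)
    moreover have "\<Phi> r - \<Phi> L \<le> L * U"
      using L_pos \<tau> U0 by (simp add: \<Phi>_def power2_eq_square)
    moreover have "L * (\<Sum>j\<in>N. (f j)\<^sup>2) \<le> L * U"
    proof -
      have "{j. j \<in> N \<and> L \<le> \<bar>d j\<bar>} = N" using LN by auto
      then show ?thesis using tail[of L] \<tau> L_pos by simp
    qed
    moreover have "(\<Sum>j\<in>N. \<bar>d j\<bar> * (f j)\<^sup>2) = (\<Sum>j\<in>N. (\<bar>d j\<bar> - L) * (f j)\<^sup>2) + L * (\<Sum>j\<in>N. (f j)\<^sup>2)"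
      by (simp add: left_diff_distrib sum_subtractf sum_distrib_left)
    ultimately show ?thesis by linarith
  qed

  \<comment> \<open>Arithmetic-geometric mean inequality for each index, weighted by
    \<open>\<bar>d j\<bar>\<close>. The split is chosen so that \<open>W\<close> is charged only
    half of the \<open>- \<tau> * W\<close> available in \<open>upper\<close>.\<close>
  have cross: "- (\<tau> / 2 * W + 2 / \<tau> * (2 * L * U)) \<le> 2 * (\<Sum>l<k. sketch u l * sketch w l)"
  proof -
    have "(\<Sum>l<k. sketch u l * sketch w l) = (\<Sum>l<k. sketch w l * sketch u l)" by (simp add: mult.commute)
    also have "\<dots> = (\<Sum>j\<in>N. x j * f j)"
      unfolding adjoint f_def[symmetric] by (rule sum.mono_neutral_cong_right) (auto simp: w_def N_def)
    finally have eq: "2 * (\<Sum>l<k. sketch u l * sketch w l) = (\<Sum>j\<in>N. 2 * (x j * f j))"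
      by (simp add: sum_distrib_left)
    have "(\<Sum>j\<in>N. - (\<tau> / 2 * (\<bar>d j\<bar> * (sketch_adj y j)\<^sup>2) + 2 / \<tau> * (\<bar>d j\<bar> * (f j)\<^sup>2))) \<le> (\<Sum>j\<in>N. 2 * (x j * f j))"
    proof (rule sum_mono)
      fix j assume "j \<in> N"
      define p where "p = \<bar>d j\<bar>"
      have p: "0 \<le> p" "d j = - p" using \<open>j \<in> N\<close> by (auto simp: p_def N_def)
      have "0 \<le> p * (\<tau> / 2 * (sketch_adj y j - 2 / \<tau> * f j)\<^sup>2)" using \<tau> p by simp
      also have "\<tau> / 2 * (sketch_adj y j - 2 / \<tau> * f j)\<^sup>2 = \<tau> / 2 * (sketch_adj y j)\<^sup>2 + 2 / \<tau> * (f j)\<^sup>2 - 2 * (sketch_adj y j * f j)"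
        using \<tau> by (simp add: power2_eq_square field_simps)
      finally have "p * (2 * (sketch_adj y j * f j)) \<le> p * (\<tau> / 2 * (sketch_adj y j)\<^sup>2 + 2 / \<tau> * (f j)\<^sup>2)"
        by (simp add: right_diff_distrib)
      also have "\<dots> = \<tau> / 2 * (p * (sketch_adj y j)\<^sup>2) + 2 / \<tau> * (p * (f j)\<^sup>2)"
        by (simp only: distrib_left mult.left_commute[of p])
      finally show "- (\<tau> / 2 * (\<bar>d j\<bar> * (sketch_adj y j)\<^sup>2) + 2 / \<tau> * (\<bar>d j\<bar> * (f j)\<^sup>2)) \<le> 2 * (x j * f j)"
        unfolding p_def[symmetric] by (simp add: x_def p(2) mult_ac)
    qed
    moreover have "(\<Sum>j\<in>N. - (\<tau> / 2 * (\<bar>d j\<bar> * (sketch_adj y j)\<^sup>2) + 2 / \<tau> * (\<bar>d j\<bar> * (f j)\<^sup>2)))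
        = - (\<tau> / 2 * W + 2 / \<tau> * (\<Sum>j\<in>N. \<bar>d j\<bar> * (f j)\<^sup>2))"
      by (simp only: sum_negf sum.distrib sum_distrib_left W_def)
    moreover have "2 / \<tau> * (\<Sum>j\<in>N. \<bar>d j\<bar> * (f j)\<^sup>2) \<le> 2 / \<tau> * (2 * L * U)"
      using f_sum \<tau> by (intro mult_left_mono) auto
    ultimately show ?thesis using eq by linarith
  qed
  have "sketch x l = sketch u l + sketch w l" for l
    unfolding sketch_def sum.distrib[symmetric]
    by (intro sum.cong) (auto simp: x_split distrib_left)
  then have "(\<Sum>l<k. (sketch x l)\<^sup>2)
      = (\<Sum>l<k. (sketch u l)\<^sup>2) + 2 * (\<Sum>l<k. sketch u l * sketch w l) + (\<Sum>l<k. (sketch w l)\<^sup>2)"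
    by (simp add: power2_sum sum.distrib sum_distrib_left mult_ac)
  moreover have "0 \<le> (\<Sum>l<k. (sketch w l)\<^sup>2)" by (simp add: sum_nonneg)
  moreover have "\<bar>(\<Sum>l<k. (sketch u l)\<^sup>2) - U\<bar> \<le> L / r * U"
    unfolding U_def using \<tau> by (intro embed_sketch(1)) (auto simp: u_def split: if_splits)
  ultimately have "U - L / r * U - (\<tau> / 2 * W + 2 / \<tau> * (2 * L * U)) < \<tau> * (U / r - W)"
    using upper cross by linarith
  moreover have "2 / \<tau> * (2 * L * U) \<le> 8 * (L / r * U)"
  proof -
    have "1 / \<tau> \<le> 2 / r" using \<tau> by (simp add: field_simps)
    then have "1 / \<tau> * (4 * L * U) \<le> 2 / r * (4 * L * U)"
      using L_pos U0 by (intro mult_right_mono) auto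
    then show ?thesis by simp
  qed
  moreover have "\<tau> * (U / r) = U - 10 * (L / r * U)"
    using \<tau> by (simp add: \<tau>_def field_simps)
  \<comment> \<open>After cancellation the strict inequality would read
    \<open>L / r * U + \<tau> / 2 * W < 0\<close>.\<close>
  moreover have "0 \<le> L / r * U" "0 \<le> \<tau> / 2 * W" using \<tau> L_pos U0 W0 by auto
  moreover have "\<tau> * (U / r - W) = \<tau> * (U / r) - 2 * (\<tau> / 2 * W)" by (simp add: right_diff_distrib)
  ultimately show False by linarith
qed

end

section \<open>Orthogonal diagonalization of real symmetric matrices\<close>

text \<open>A complex eigenvalue exists, and symmetry makes it equal to its conjugate. Its complex
  eigenvector need not be real, so the argument returns through the characteristic polynomial, whose
  real root has a real eigenvector.\<close>

lemma symmetric_eigenvector_exists: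
  fixes A :: "real mat"
  assumes A: "A \<in> carrier_mat n n" and sym: "A\<^sup>T = A" and n: "0 < n"
  shows "\<exists>v e. eigenvector A v e"
proof -
  interpret of_real_hom: field_hom "of_real :: real \<Rightarrow> complex"
    by unfold_locales auto
  define C where "C = map_mat complex_of_real A"
  have C: "C \<in> carrier_mat n n" using A by (simp add: C_def)
  obtain as where as: "char_poly C = (\<Prod>a\<leftarrow>as. [:- a, 1:])" "length as = n"
    using char_poly_factorized[OF C] by blast
  then obtain z where "z \<in> set as" using n by (cases as) auto
  then have "poly (char_poly C) z = 0"
    by (auto simp: as poly_prod_list prod_list_zero_iff intro!: bexI[of _ z])
  then obtain v where ev: "eigenvector C v z"
    using eigenvalue_root_char_poly[OF C] by (auto simp: eigenvalue_def)
  then have v: "v \<in> carrier_vec n" "v \<noteq> 0\<^sub>v n" "C *\<^sub>v v = z \<cdot>\<^sub>v v"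
    using C by (auto simp: eigenvector_def)
  have C_herm: "C\<^sup>T *\<^sub>v conjugate v = conjugate (C *\<^sub>v v)"
  proof (rule eq_vecI)
    fix i assume "i < dim_vec (conjugate (C *\<^sub>v v))"
    then have i: "i < n" using C by simp
    have entry: "cnj (C $$ (i, j)) = C $$ (j, i)" if "j < n" for j
    proof -
      have "A $$ (i, j) = A\<^sup>T $$ (j, i)" using A i that by simp
      then show ?thesis using A i that sym by (simp add: C_def)
    qed
    have "(C\<^sup>T *\<^sub>v conjugate v) $ i = (\<Sum>j = 0..<n. C $$ (j, i) * cnj (v $ j))"
      using C v i by (simp add: scalar_prod_def)
    also have "\<dots> = cnj (\<Sum>j = 0..<n. C $$ (i, j) * v $ j)"
      using entry by simp
    also have "\<dots> = cnj ((C *\<^sub>v v) $ i)"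
      using C v(1) i by (simp add: scalar_prod_def del: v(3))
    also have "\<dots> = conjugate (C *\<^sub>v v) $ i" using C i by simp
    finally show "(C\<^sup>T *\<^sub>v conjugate v) $ i = conjugate (C *\<^sub>v v) $ i" .
  qed (use C in simp)
  have "cnj z * (v \<bullet>c v) = conjugate (z \<cdot>\<^sub>v v) \<bullet> v"
    using v by (simp add: conjugate_smult_vec comm_scalar_prod[of v n])
  also have "\<dots> = (C\<^sup>T *\<^sub>v conjugate v) \<bullet> v" using C_herm v by simp
  also have "\<dots> = conjugate v \<bullet> (C *\<^sub>v v)"
    using C v by (intro transpose_vec_mult_scalar) auto
  also have "\<dots> = z * (v \<bullet>c v)" using v by (simp add: comm_scalar_prod[of v n])
  finally have "cnj z = z" using v by simp
  then have "z \<in> \<real>" by (simp add: Reals_cnj_iff)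
  then obtain e where e: "z = of_real e" by (auto elim: Reals_cases)
  have "poly (char_poly C) (of_real e) = 0" using \<open>poly (char_poly C) z = 0\<close> e by simp
  then have "poly (char_poly A) e = 0"
    unfolding C_def of_real_hom.char_poly_hom[OF A] by simp
  then show ?thesis using eigenvalue_root_char_poly[OF A] unfolding eigenvalue_def by blast
qed

text \<open>Complete \<open>v\<close> to a basis and orthogonalize: Gram-Schmidt keeps the first
  vector, and normalizing only rescales it, whence \<open>c\<close>.\<close>

lemma orthogonal_mat_with_first_col:
  fixes v :: "real vec"
  assumes v: "v \<in> carrier_vec n" "v \<noteq> 0\<^sub>v n"
  shows "\<exists>W\<in>carrier_mat n n. \<exists>c. W\<^sup>T * W = 1\<^sub>m n \<and> col W 0 = c \<cdot>\<^sub>v v"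
proof -
  interpret cof_vec_space n "TYPE(real)" .
  have n: "n \<noteq> 0" using v by auto
  define bs where "bs = basis_completion v"
  define ws where "ws = gram_schmidt n bs"
  from basis_completion[OF v, folded bs_def]
  have bs: "distinct bs" "\<not> lin_dep (set bs)" "set bs \<subseteq> carrier_vec n" "hd bs = v" "length bs = n"
    by auto
  then obtain vs where bs_Cons: "bs = v # vs" using n by (cases bs) auto
  have ws: "set ws \<subseteq> carrier_vec n" "corthogonal ws" "length ws = n"
    using gram_schmidt_result[OF bs(3,1,2) refl] bs(5) by (auto simp: ws_def)
  have hd_ws: "hd ws = v" using gram_schmidt_hd[OF v(1), of vs] by (simp add: ws_def bs_Cons)
  have ws_carrier: "ws ! i \<in> carrier_vec n" if "i < n" for i using ws that by auto
  define W where "W = mat_of_cols n (map (\<lambda>w. (1 / sqrt (w \<bullet> w)) \<cdot>\<^sub>v w) ws)"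
  have W: "W \<in> carrier_mat n n" using ws by (auto simp: W_def)
  have col_W: "col W i = (1 / sqrt (ws ! i \<bullet> ws ! i)) \<cdot>\<^sub>v (ws ! i)" if "i < n" for i
    using that ws ws_carrier by (simp add: W_def)
  have orth: "ws ! i \<bullet> ws ! j = 0 \<longleftrightarrow> i \<noteq> j" if "i < n" "j < n" for i j
    using corthogonalD[OF ws(2), of i j] that ws by simp
  have "W\<^sup>T * W = 1\<^sub>m n"
  proof (rule eq_matI)
    fix i j assume "i < dim_row (1\<^sub>m n :: real mat)" "j < dim_col (1\<^sub>m n :: real mat)"
    then have ij: "i < n" "j < n" by auto
    have pos: "0 < ws ! i \<bullet> ws ! i"
      using orth[of i i] conjugate_square_greater_0_vec[OF ws_carrier[OF ij(1)]] ij ws_carrier[OF ij(1)]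
      by auto
    have "(W\<^sup>T * W) $$ (i, j) = col W i \<bullet> col W j" using W ij by simp
    also have "\<dots> = 1 / sqrt (ws ! i \<bullet> ws ! i) * (1 / sqrt (ws ! j \<bullet> ws ! j) * (ws ! i \<bullet> ws ! j))"
      using ij ws_carrier[OF ij(1)] ws_carrier[OF ij(2)] by (simp add: col_W)
    also have "\<dots> = (if i = j then 1 else 0)"
      using orth[OF ij] pos by auto
    finally show "(W\<^sup>T * W) $$ (i, j) = 1\<^sub>m n $$ (i, j)" using ij by simp
  qed (use W in auto)
  moreover have "col W 0 = (1 / sqrt (v \<bullet> v)) \<cdot>\<^sub>v v"
    using col_W[of 0] n hd_ws ws hd_conv_nth[of ws] by auto
  ultimately show ?thesis using W by blast
qed

text \<open>Deflation: conjugating by an orthogonal matrix whose first column is an eigenvector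
  gives, by symmetry, a block diagonal matrix, and the induction hypothesis diagonalizes the smaller
  block.\<close>

lemma symmetric_orthogonal_diagonalization:
  fixes A :: "real mat"
  assumes "A \<in> carrier_mat n n" "A\<^sup>T = A"
  shows "\<exists>U\<in>carrier_mat n n. \<exists>d. U\<^sup>T * U = 1\<^sub>m n \<and> U\<^sup>T * A * U = mat n n (\<lambda>(i, j). if i = j then d i else 0)"
  using assms
proof (induction n arbitrary: A)
  case 0
  then show ?case by (intro bexI[of _ "1\<^sub>m 0"] exI[of _ "\<lambda>_. 0"]) auto
next
  case (Suc m)
  note A = Suc.prems(1) and sym = Suc.prems(2)
  obtain v e where "eigenvector A v e" using symmetric_eigenvector_exists[OF A sym] by auto
  then have v: "v \<in> carrier_vec (Suc m)" "v \<noteq> 0\<^sub>v (Suc m)" "A *\<^sub>v v = e \<cdot>\<^sub>v v"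
    using A by (auto simp: eigenvector_def)
  obtain W c where W: "W \<in> carrier_mat (Suc m) (Suc m)" and WW: "W\<^sup>T * W = 1\<^sub>m (Suc m)"
    and col_W: "col W 0 = c \<cdot>\<^sub>v v"
    using orthogonal_mat_with_first_col[OF v(1,2)] by blast
  define B where "B = W\<^sup>T * A * W"
  have B: "B \<in> carrier_mat (Suc m) (Suc m)" using W A by (simp add: B_def)
  have B_sym: "B\<^sup>T = B"
    using W A sym
    by (simp add: B_def transpose_mult[of _ "Suc m" "Suc m" _ "Suc m"] assoc_mult_mat[of _ "Suc m" "Suc m" _ "Suc m" _ "Suc m"])
  have B_swap: "B $$ (i, j) = B $$ (j, i)" if "i < Suc m" "j < Suc m" for i j
    using arg_cong[OF B_sym, of "\<lambda>M. M $$ (i, j)"] B that by simp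
  have B0: "B $$ (i, 0) = (if i = 0 then e else 0)" if i: "i < Suc m" for i
  proof -
    have "A *\<^sub>v col W 0 = e \<cdot>\<^sub>v col W 0"
      using A v by (simp add: col_W mult_mat_vec[of A "Suc m" "Suc m"] smult_smult_assoc mult.commute)
    moreover have "B $$ (i, 0) = col W i \<bullet> (A *\<^sub>v col W 0)"
      using W A i by (simp add: B_def assoc_mult_mat[of _ "Suc m" "Suc m" _ "Suc m" _ "Suc m"]
          col_mult2[of A "Suc m" "Suc m"] mult_mat_vec_def)
    moreover have "col W i \<bullet> col W 0 = (W\<^sup>T * W) $$ (i, 0)" using W i by simp
    ultimately show ?thesis using W i WW by simp
  qed
  define B' where "B' = mat m m (\<lambda>(i, j). B $$ (Suc i, Suc j))"
  have B': "B' \<in> carrier_mat m m" by (simp add: B'_def)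
  have "B'\<^sup>T = B'" using B_swap by (intro eq_matI) (auto simp: B'_def)
  from Suc.IH[OF B' this] obtain U d where U: "U \<in> carrier_mat m m" "U\<^sup>T * U = 1\<^sub>m m"
    "U\<^sup>T * B' * U = mat m m (\<lambda>(i, j). if i = j then d i else 0)" by blast
  define E where "E = mat 1 1 (\<lambda>_. e)"
  have E: "E \<in> carrier_mat 1 1" by (simp add: E_def)
  have B_block: "B = four_block_mat E (0\<^sub>m 1 m) (0\<^sub>m m 1) B'"
  proof (rule eq_matI)
    fix i j assume "i < dim_row (four_block_mat E (0\<^sub>m 1 m) (0\<^sub>m m 1) B')"
      "j < dim_col (four_block_mat E (0\<^sub>m 1 m) (0\<^sub>m m 1) B')"
    then have ij: "i < Suc m" "j < Suc m" by (auto simp: E_def B'_def)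
    show "B $$ (i, j) = four_block_mat E (0\<^sub>m 1 m) (0\<^sub>m m 1) B' $$ (i, j)"
      using ij B0[of i] B0[of j] B_swap[of i j] by (cases i; cases j) (auto simp: E_def B'_def)
  qed (use B in \<open>auto simp: E_def B'_def\<close>)
  define U' where "U' = four_block_mat (1\<^sub>m 1) (0\<^sub>m 1 m) (0\<^sub>m m 1) U"
  have U': "U' \<in> carrier_mat (Suc m) (Suc m)"
    unfolding U'_def using four_block_carrier_mat[OF one_carrier_mat[of 1] U(1)] by simp
  have U'T: "U'\<^sup>T = four_block_mat (1\<^sub>m 1) (0\<^sub>m 1 m) (0\<^sub>m m 1) U\<^sup>T"
    using U unfolding U'_def by (subst transpose_four_block_mat) auto
  have UU: "U'\<^sup>T * U' = 1\<^sub>m (Suc m)"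
    unfolding U'T unfolding U'_def using U
    by (subst mult_four_block_mat[of _ 1 1 _ m _ m _ _ 1 _ m]) auto
  have UBU: "U'\<^sup>T * B * U' = four_block_mat E (0\<^sub>m 1 m) (0\<^sub>m m 1) (U\<^sup>T * B' * U)"
    unfolding U'T B_block unfolding U'_def using U E B'
    by (simp add: mult_four_block_mat[of _ 1 1 _ m _ m _ _ 1 _ m])
  define d' where "d' i = (case i of 0 \<Rightarrow> e | Suc j \<Rightarrow> d j)" for i
  have "U'\<^sup>T * B * U' = mat (Suc m) (Suc m) (\<lambda>(i, j). if i = j then d' i else 0)"
    unfolding UBU U(3)
    by (rule eq_matI) (auto simp: E_def d'_def split: nat.splits)
  moreover have "(W * U')\<^sup>T * A * (W * U') = U'\<^sup>T * B * U'"
    using W U' A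
    by (simp add: B_def transpose_mult[of _ "Suc m" "Suc m" _ "Suc m"] assoc_mult_mat[of _ "Suc m" "Suc m" _ "Suc m" _ "Suc m"])
  moreover have "(W * U')\<^sup>T * (W * U') = U'\<^sup>T * (W\<^sup>T * W) * U'"
    using W U'
    by (simp add: transpose_mult[of _ "Suc m" "Suc m" _ "Suc m"] assoc_mult_mat[of _ "Suc m" "Suc m" _ "Suc m" _ "Suc m"])
  then have "(W * U')\<^sup>T * (W * U') = 1\<^sub>m (Suc m)" using UU WW U' by simp
  ultimately show ?case using W U' by (intro bexI[of _ "W * U'"]) auto
qed

lemma eigs_orthogonal_diagonalization:
  assumes A: "A \<in> carrier_mat n n" and U: "U \<in> carrier_mat n n" "U\<^sup>T * U = 1\<^sub>m n"
    and diag: "U\<^sup>T * A * U = mat n n (\<lambda>(i, j). if i = j then d i else 0)"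
  shows "eigs A = image_mset d (mset_set {..<n})"
proof -
  define D where "D = mat n n (\<lambda>(i, j). if i = j then d i else 0 :: real)"
  have D: "D \<in> carrier_mat n n" by (simp add: D_def)
  have UU: "U * U\<^sup>T = 1\<^sub>m n" by (rule mat_mult_left_right_inverse[of "U\<^sup>T" n U]) (use U in auto)
  have "U * D * U\<^sup>T = (U * U\<^sup>T) * A * (U * U\<^sup>T)"
    unfolding D_def diag[symmetric] using U(1) A by (simp add: assoc_mult_mat[of _ n n _ n _ n])
  then have "A = U * D * U\<^sup>T" using UU A by simp
  then have "similar_mat A D"
    unfolding similar_mat_def using similar_mat_witI[OF UU U(2) _ A D U(1)] U(1)
    by (metis transpose_carrier_mat)
  then have "char_poly A = char_poly D" by (rule char_poly_similar)
  also have "\<dots> = (\<Prod>a\<leftarrow>diag_mat D. [:- a, 1:])"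
    by (rule char_poly_upper_triangular[OF D]) (auto simp: D_def upper_triangular_def)
  also have "diag_mat D = map d [0..<n]" by (auto simp: diag_mat_def D_def)
  finally have cp: "char_poly A = (\<Prod>p\<leftarrow>map (\<lambda>j. [:- d j, 1:]) [0..<n]. p)" by (simp add: comp_def)
  have "eigs A = (\<Sum>j\<leftarrow>[0..<n]. {#d j#})"
    unfolding eigs_def cp by (subst proots_prod_list) (auto simp: comp_def)
  also have "\<dots> = image_mset d (mset [0..<n])" by (induction n) auto
  also have "mset [0..<n] = mset_set {..<n}" by (simp add: lessThan_atLeast0)
  finally show ?thesis .
qed

section \<open>Eigenvalue counts and transfer to matrices\<close>

lemma length_filter_le_if_suffix_fails:
  assumes "\<And>j. i \<le> j \<Longrightarrow> j < length xs \<Longrightarrow> \<not> P (xs ! j)"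
  shows "length (filter P xs) \<le> i"
proof -
  have "filter P (drop i xs) = []"
    using assms by (force simp: filter_empty_conv in_set_conv_nth)
  then have "filter P xs = filter P (take i xs)"
    by (metis append_Nil2 append_take_drop_id filter_append)
  also have "length \<dots> \<le> i" by (rule order.trans[OF length_filter_le]) simp
  finally show ?thesis .
qed

lemma length_filter_ge_if_prefix_holds:
  assumes "\<And>j. j < i \<Longrightarrow> P (xs ! j)" "i \<le> length xs"
  shows "i \<le> length (filter P xs)"
proof -
  have "filter P (take i xs) = take i xs"
    using assms by (auto simp: filter_id_conv in_set_conv_nth)
  then have "i = length (filter P (take i xs))" using assms(2) by simp
  also have "\<dots> \<le> length (filter P (take i xs) @ filter P (drop i xs))" by simp
  also have "\<dots> = length (filter P xs)" by (metis append_take_drop_id filter_append)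
  finally show ?thesis .
qed

lemma size_filter_eigs: "size (filter_mset P (eigs M)) = length (filter P (rev (sorted_list_of_multiset (eigs M))))"
proof -
  have "mset (filter P (rev (sorted_list_of_multiset (eigs M)))) = filter_mset P (eigs M)"
    by (simp add: mset_filter)
  then show ?thesis by (metis size_mset)
qed

lemma length_sorted_eigs [simp]: "length (sorted_list_of_multiset (eigs M)) = size (eigs M)"
  by (metis mset_sorted_list_of_multiset size_mset)

lemma descending_eigs:
  "i \<le> j \<Longrightarrow> j < size (eigs M) \<Longrightarrow>
    rev (sorted_list_of_multiset (eigs M)) ! j \<le> rev (sorted_list_of_multiset (eigs M)) ! i"
  by (rule sorted_rev_nth_mono) auto

lemma lam_in_eigs: "1 \<le> i \<Longrightarrow> i \<le> size (eigs M) \<Longrightarrow> lam M i \<in># eigs M"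
proof -
  assume "1 \<le> i" "i \<le> size (eigs M)"
  then have "lam M i \<in> set (rev (sorted_list_of_multiset (eigs M)))"
    unfolding lam_def by (intro nth_mem) simp
  then show ?thesis by simp
qed

text \<open>This lemma and the next three trade the position \<open>i\<close> in the descending list
  for counts beyond a threshold. Monotonicity carries a comparison at position \<open>i - 1\<close>,
  where \<open>lam\<close> reads the list, to all later or all earlier positions.\<close>

lemma lam_ge:
  assumes "1 \<le> i" "i \<le> size {#x \<in># eigs M. t \<le> x#}"
  shows "t \<le> lam M i"
proof (rule ccontr)
  assume "\<not> ?thesis"
  then have "length (filter (\<lambda>x. t \<le> x) (rev (sorted_list_of_multiset (eigs M)))) \<le> i - 1"
    using descending_eigs[of "i - 1" _ M] by (intro length_filter_le_if_suffix_fails) (force simp: lam_def)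
  then show False using assms by (simp add: size_filter_eigs)
qed

lemma lam_le:
  assumes "1 \<le> i" "i \<le> size (eigs M)" "size {#x \<in># eigs M. t < x#} < i"
  shows "lam M i \<le> t"
proof (rule ccontr)
  assume *: "\<not> ?thesis"
  have "i \<le> length (filter (\<lambda>x. t < x) (rev (sorted_list_of_multiset (eigs M))))"
  proof (rule length_filter_ge_if_prefix_holds)
    fix j assume "j < i"
    then show "t < rev (sorted_list_of_multiset (eigs M)) ! j"
      using descending_eigs[of j "i - 1" M] * assms by (force simp: lam_def)
  qed (use assms in simp)
  then show False using assms by (simp add: size_filter_eigs)
qed

lemma size_greater_lam:
  assumes "1 \<le> i"
  shows "size {#x \<in># eigs M. lam M i < x#} < i"
proof -
  have "length (filter (\<lambda>x. lam M i < x) (rev (sorted_list_of_multiset (eigs M)))) \<le> i - 1"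
    using descending_eigs[of "i - 1" _ M] by (intro length_filter_le_if_suffix_fails) (force simp: lam_def)
  then show ?thesis using assms by (simp add: size_filter_eigs)
qed

lemma size_ge_lam:
  assumes "1 \<le> i" "i \<le> size (eigs M)"
  shows "i \<le> size {#x \<in># eigs M. lam M i \<le> x#}"
proof -
  have "i \<le> length (filter (\<lambda>x. lam M i \<le> x) (rev (sorted_list_of_multiset (eigs M))))"
  proof (rule length_filter_ge_if_prefix_holds)
    fix j assume "j < i"
    then show "lam M i \<le> rev (sorted_list_of_multiset (eigs M)) ! j"
      using descending_eigs[of j "i - 1" M] assms by (force simp: lam_def)
  qed (use assms in simp)
  then show ?thesis by (simp add: size_filter_eigs)
qed

lemma size_filter_image_mset_set:
  "size (filter_mset P (image_mset d (mset_set {..<n::nat}))) = card {j. j < n \<and> P (d j)}"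
  by (simp add: filter_mset_image_mset filter_mset_mset_set comp_def)

section \<open>Coordinates in an orthonormal eigenbasis\<close>

lemma scalar_prod_orthogonal_mult:
  fixes U :: "real mat"
  assumes U: "U \<in> carrier_mat n m" "U\<^sup>T * U = 1\<^sub>m m" and x: "x \<in> carrier_vec m"
  shows "(U *\<^sub>v x) \<bullet> (U *\<^sub>v x) = x \<bullet> x"
proof -
  have "(U *\<^sub>v x) \<bullet> (U *\<^sub>v x) = (U\<^sup>T *\<^sub>v (U *\<^sub>v x)) \<bullet> x"
    using transpose_vec_mult_scalar[OF U(1) x, of "U *\<^sub>v x"] U x by simp
  also have "U\<^sup>T *\<^sub>v (U *\<^sub>v x) = x"
    using assoc_mult_mat_vec[of "U\<^sup>T" m n U m x] U x by simp
  finally show ?thesis .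
qed

lemma scalar_prod_vec_self: "vec n x \<bullet> vec n x = (\<Sum>j<n. (x j)\<^sup>2)"
  for x :: "nat \<Rightarrow> real"
  by (simp add: scalar_prod_def power2_eq_square lessThan_atLeast0)

lemma vnorm_square: "(vnorm v)\<^sup>2 = v \<bullet> v"
  unfolding vnorm_def by (simp add: scalar_prod_def sum_nonneg)

text \<open>The order of \<open>d\<close> is left open, because only counts of eigenvalues
  matter.\<close>

locale orthogonal_diagonalization =
  fixes A U :: "real mat" and n :: nat and d :: "nat \<Rightarrow> real"
  assumes A: "A \<in> carrier_mat n n" and U: "U \<in> carrier_mat n n"
    and UU: "U\<^sup>T * U = 1\<^sub>m n"
    and diag: "U\<^sup>T * A * U = mat n n (\<lambda>(i, j). if i = j then d i else 0)"
begin

lemma UU': "U * U\<^sup>T = 1\<^sub>m n"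
  by (rule mat_mult_left_right_inverse[of "U\<^sup>T" n U]) (use U UU in auto)

lemma eigs: "eigs A = image_mset d (mset_set {..<n})"
  by (rule eigs_orthogonal_diagonalization[OF A U UU diag])

lemma size_eigs: "size (eigs A) = n"
  by (simp add: eigs)

lemma size_filter: "size (filter_mset P (eigs A)) = card {j. j < n \<and> P (d j)}"
  unfolding eigs by (rule size_filter_image_mset_set)

lemma decomp: "A = U * mat n n (\<lambda>(i, j). if i = j then d i else 0) * U\<^sup>T"
proof -
  have "U * (U\<^sup>T * A * U) * U\<^sup>T = (U * U\<^sup>T) * A * (U * U\<^sup>T)"
    using U A by (simp add: assoc_mult_mat[of _ n n _ n _ n])
  then show ?thesis unfolding diag using UU' A by simp
qed

lemma col_inner:
  assumes "i < n" "j < n"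
  shows "col U i \<bullet> col U j = (if i = j then 1 else 0)"
proof -
  have "col U i \<bullet> col U j = (U\<^sup>T * U) $$ (i, j)" using U assms by simp
  then show ?thesis using UU assms by simp
qed

lemma mult_vec: "A *\<^sub>v (U *\<^sub>v vec n x) = U *\<^sub>v vec n (\<lambda>j. d j * x j)"
proof -
  define D where "D = mat n n (\<lambda>(i, j). if i = j then d i else 0 :: real)"
  have D: "D \<in> carrier_mat n n" by (simp add: D_def)
  have "A * U = U * D * (U\<^sup>T * U)"
    using U D by (subst decomp) (simp add: D_def[symmetric] assoc_mult_mat[of _ n n _ n _ n])
  then have AU: "A * U = U * D" using UU U D by simp
  have "D *\<^sub>v vec n x = vec n (\<lambda>j. d j * x j)"
  proof (rule eq_vecI)
    fix i assume "i < dim_vec (vec n (\<lambda>j. d j * x j))"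
    then have i: "i < n" by simp
    have "(D *\<^sub>v vec n x) $ i = (\<Sum>j = 0..<n. (if i = j then d i else 0) * x j)"
      using i unfolding D_def by (simp add: scalar_prod_def)
    also have "\<dots> = (\<Sum>j = 0..<n. if j = i then d i * x i else 0)" by (intro sum.cong) auto
    finally show "(D *\<^sub>v vec n x) $ i = vec n (\<lambda>j. d j * x j) $ i" using i by simp
  qed (use D in simp)
  moreover have "A *\<^sub>v (U *\<^sub>v vec n x) = U *\<^sub>v (D *\<^sub>v vec n x)"
    using assoc_mult_mat_vec[OF A U, of "vec n x"] assoc_mult_mat_vec[OF U D, of "vec n x"] AU by simp
  ultimately show ?thesis by simp
qed

lemma eigenvector_col:
  assumes "j < n"
  shows "eigenvector A (col U j) (d j)"
proof -
  have col: "col U j = U *\<^sub>v vec n (\<lambda>i. if i = j then 1 else 0)"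
  proof (rule eq_vecI)
    fix i assume "i < dim_vec (U *\<^sub>v vec n (\<lambda>i. if i = j then 1 else 0))"
    then show "col U j $ i = (U *\<^sub>v vec n (\<lambda>i. if i = j then 1 else 0)) $ i"
      using U assms by (simp add: scalar_prod_def if_distrib sum.delta cong: if_cong)
  qed (use U in simp)
  have "vec n (\<lambda>i. d i * (if i = j then 1 else 0)) = d j \<cdot>\<^sub>v vec n (\<lambda>i. if i = j then 1 else 0)"
    by (intro eq_vecI) auto
  then have "A *\<^sub>v col U j = d j \<cdot>\<^sub>v col U j"
    unfolding col mult_vec using U by (simp add: mult_mat_vec[of U n n])
  moreover have "col U j \<noteq> 0\<^sub>v n"
    using col_inner[OF assms assms] U by auto
  moreover have "col U j \<in> carrier_vec n" using U by (intro carrier_vecI) simp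
  ultimately show ?thesis using A by (simp add: eigenvector_def)
qed

text \<open>Supplies the vectors to which Assumption L applies. Coordinates are added one at a time,
  each bringing a multiple of an eigenvector at level \<open>t\<close> or the zero vector.\<close>

lemma in_top_eigspan:
  assumes supp: "\<And>j. j < n \<Longrightarrow> x j \<noteq> 0 \<Longrightarrow> t \<le> \<bar>d j\<bar>"
  shows "U *\<^sub>v vec n x \<in> top_eigspan A t"
proof -
  interpret vec_space "TYPE(real)" n .
  define E where "E = {v. \<exists>k. eigenvector A v k \<and> \<bar>k\<bar> \<ge> t}"
  have E: "E \<subseteq> carrier_vec n" using A by (auto simp: E_def eigenvector_def)
  have "U *\<^sub>v vec n (\<lambda>j. if j < m then x j else 0) \<in> span E" if "m \<le> n" for m
    using that
  proof (induction m)
    case 0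
    have "U *\<^sub>v vec n (\<lambda>j. 0) = 0\<^sub>v n" using U by (intro eq_vecI) (auto simp: scalar_prod_def)
    then show ?case using span_zero by simp
  next
    case (Suc m)
    have eq: "U *\<^sub>v vec n (\<lambda>j. if j < Suc m then x j else 0)
        = U *\<^sub>v vec n (\<lambda>j. if j < m then x j else 0) + x m \<cdot>\<^sub>v col U m"
    proof (rule eq_vecI)
      fix i assume "i < dim_vec (U *\<^sub>v vec n (\<lambda>j. if j < m then x j else 0) + x m \<cdot>\<^sub>v col U m)"
      then have i: "i < n" using U by simp
      have "(\<Sum>j = 0..<n. U $$ (i, j) * (if j < Suc m then x j else 0))
          = (\<Sum>j = 0..<n. U $$ (i, j) * (if j < m then x j else 0) + (if j = m then x m * U $$ (i, m) else 0))"
        by (intro sum.cong) auto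
      also have "\<dots> = (\<Sum>j = 0..<n. U $$ (i, j) * (if j < m then x j else 0)) + x m * U $$ (i, m)"
        using Suc.prems by (simp add: sum.distrib)
      finally show "(U *\<^sub>v vec n (\<lambda>j. if j < Suc m then x j else 0)) $ i
          = (U *\<^sub>v vec n (\<lambda>j. if j < m then x j else 0) + x m \<cdot>\<^sub>v col U m) $ i"
        using U i Suc.prems by (simp add: scalar_prod_def)
    qed (use U in simp)
    have "x m \<cdot>\<^sub>v col U m \<in> span E"
    proof (cases "x m = 0")
      case True
      then have "x m \<cdot>\<^sub>v col U m = 0\<^sub>v n" using U by (intro eq_vecI) auto
      then show ?thesis using span_zero by simp
    next
      case False
      then have "col U m \<in> E"
        using supp[of m] Suc.prems eigenvector_col[of m] by (auto simp: E_def)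
      then show ?thesis using E by (intro smult_in_span span_mem) auto
    qed
    then show ?case unfolding eq using Suc E by (intro span_add1) auto
  qed
  from this[of n] have "U *\<^sub>v vec n (\<lambda>j. if j < n then x j else 0) \<in> span E" by simp
  also have "vec n (\<lambda>j. if j < n then x j else 0) = vec n x" by (intro eq_vecI) auto
  finally show ?thesis using A by (simp add: top_eigspan_def E_def)
qed

lemma abs_le_opnorm:
  assumes j: "j < n"
  shows "\<bar>d j\<bar> \<le> opnorm A"
proof -
  define B where "B = {vnorm (A *\<^sub>v v) | v. v \<in> carrier_vec (dim_col A) \<and> vnorm v \<le> 1}"
  \<comment> \<open>This crude Frobenius bound only serves to make \<open>B\<close> bounded above,
    so that its \<open>Sup\<close> dominates every member.\<close>
  have "vnorm (A *\<^sub>v v) \<le> sqrt (\<Sum>j<n. (d j)\<^sup>2)" if v: "v \<in> carrier_vec n" "vnorm v \<le> 1" for v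
  proof -
    define x where "x j = (U\<^sup>T *\<^sub>v v) $ j" for j
    have vx: "vec n x = U\<^sup>T *\<^sub>v v" using U by (intro eq_vecI) (auto simp: x_def)
    have v_eq: "v = U *\<^sub>v vec n x"
      using assoc_mult_mat_vec[of U n n "U\<^sup>T" n v] U v UU' by (simp add: vx)
    have "v \<bullet> v = (\<Sum>j<n. (x j)\<^sup>2)"
      using scalar_prod_orthogonal_mult[OF U UU, of "vec n x"] by (simp add: v_eq scalar_prod_vec_self)
    then have "(\<Sum>j<n. (x j)\<^sup>2) \<le> 1" using v(2) by (simp add: vnorm_def)
    then have x1: "(x j)\<^sup>2 \<le> 1" if "j < n" for j
      using member_le_sum[of j "{..<n}" "\<lambda>j. (x j)\<^sup>2"] that by simp
    have "(A *\<^sub>v v) \<bullet> (A *\<^sub>v v) = (\<Sum>j<n. (d j * x j)\<^sup>2)"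
      using scalar_prod_orthogonal_mult[OF U UU, of "vec n (\<lambda>j. d j * x j)"]
      by (simp add: v_eq mult_vec scalar_prod_vec_self)
    also have "\<dots> \<le> (\<Sum>j<n. (d j)\<^sup>2)"
      using x1 by (intro sum_mono) (auto simp: power_mult_distrib intro: mult_left_le)
    finally show ?thesis unfolding vnorm_def by (rule real_sqrt_le_mono)
  qed
  then have "bdd_above B" using A unfolding B_def by (intro bdd_aboveI) auto
  moreover have "\<bar>d j\<bar> \<in> B"
  proof -
    have "A *\<^sub>v col U j = d j \<cdot>\<^sub>v col U j"
      using eigenvector_col[OF j] by (simp add: eigenvector_def)
    moreover have "col U j \<in> carrier_vec n" using U by auto
    ultimately have "vnorm (A *\<^sub>v col U j) = \<bar>d j\<bar>" "vnorm (col U j) \<le> 1"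
      using col_inner[OF j j] by (auto simp: vnorm_def real_sqrt_mult)
    then show ?thesis using \<open>col U j \<in> carrier_vec n\<close> A unfolding B_def by force
  qed
  ultimately show ?thesis unfolding opnorm_def B_def[symmetric] by (intro cSup_upper)
qed

end

section \<open>From coordinates back to matrices\<close>

lemma symmetric_diagonalization_exists:
  assumes "A \<in> carrier_mat n n" "A\<^sup>T = A"
  shows "\<exists>U d. orthogonal_diagonalization A U n d"
  using symmetric_orthogonal_diagonalization[OF assms] assms(1)
  unfolding orthogonal_diagonalization_def by blast

text \<open>With \<open>R = W\<^sup>T * S * U\<close>, the identity
  \<open>R D R\<^sup>T = W\<^sup>T M W\<close> gives \<open>diagonal\<close>; since \<open>U\<close>
  and \<open>W\<^sup>T\<close> preserve norms, Assumption L becomes \<open>embed\<close>.\<close>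

lemma sketched_spectrum_coordinates:
  assumes A: "orthogonal_diagonalization A U n d"
    and S: "S \<in> carrier_mat k n"
    and M: "orthogonal_diagonalization (S * A * S\<^sup>T) W k e"
    and L: "0 < L" and gap: "\<forall>x \<in># eigs A. x \<noteq> 0 \<longrightarrow> \<bar>x\<bar> \<ge> L" and embed: "assumption_L S A L"
  shows "sketched_spectrum n k d e (\<lambda>l j. (W\<^sup>T * S * U) $$ (l, j)) L"
proof -
  interpret A: orthogonal_diagonalization A U n d by (rule A)
  interpret M: orthogonal_diagonalization "S * A * S\<^sup>T" W k e by (rule M)
  define R where "R = W\<^sup>T * S * U"
  have R: "R \<in> carrier_mat k n" using S A.U M.U by (simp add: R_def)
  define D where "D = mat n n (\<lambda>(i, j). if i = j then d i else 0 :: real)"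
  have D: "D \<in> carrier_mat n n" by (simp add: D_def)
  have "R * D * R\<^sup>T = W\<^sup>T * S * (U * D * U\<^sup>T) * (S\<^sup>T * W)"
  proof -
    have WS: "W\<^sup>T * S \<in> carrier_mat k n" using S M.U by simp
    have "(W\<^sup>T * S)\<^sup>T = S\<^sup>T * W" using S M.U by (simp add: transpose_mult[of _ k k _ n])
    then have "R\<^sup>T = U\<^sup>T * (S\<^sup>T * W)"
      unfolding R_def using WS A.U by (simp add: transpose_mult[of _ k n _ n])
    moreover have SW: "S\<^sup>T * W \<in> carrier_mat n k" using S M.U by simp
    ultimately show ?thesis
      unfolding R_def using WS SW A.U D
      by (simp add: assoc_mult_mat[of _ k n _ n _ n] assoc_mult_mat[of _ k n _ n _ k] assoc_mult_mat[of _ n n _ n _ n]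
        assoc_mult_mat[of _ n n _ n _ k])
  qed
  also have "\<dots> = W\<^sup>T * (S * A * S\<^sup>T) * W"
    unfolding D_def A.decomp[symmetric] using S A.A M.U
    by (simp add: assoc_mult_mat[of _ k k _ n _ n] assoc_mult_mat[of _ k n _ n _ n] assoc_mult_mat[of _ k n _ n _ k] 
        assoc_mult_mat[of _ n n _ n _ k] assoc_mult_mat[of _ k k _ n _ k] assoc_mult_mat[of _ k n _ k _ k]
        assoc_mult_mat[of _ k k _ k _ k] assoc_mult_mat[of _ n n _ k _ k] assoc_mult_mat[of _ n k _ k _ k])
  finally have RDR: "R * D * R\<^sup>T = mat k k (\<lambda>(i, j). if i = j then e i else 0)" unfolding M.diag .
  show ?thesis
  proof (unfold_locales)
    show "0 < L" by (rule L)
  next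
    fix l l' assume l: "l < k" "l' < k"
    have RD: "(R * D) $$ (l, j) = R $$ (l, j) * d j" if "j < n" for j
    proof -
      have "(R * D) $$ (l, j) = (\<Sum>i = 0..<n. R $$ (l, i) * (if i = j then d i else 0))"
        using R l that unfolding D_def by (simp add: scalar_prod_def)
      also have "\<dots> = (\<Sum>i = 0..<n. if i = j then R $$ (l, j) * d j else 0)"
        by (intro sum.cong) auto
      finally show ?thesis using that by simp
    qed
    have "(R * D * R\<^sup>T) $$ (l, l') = row (R * D) l \<bullet> col R\<^sup>T l'"
      using R D l by (intro index_mult_mat(1)) auto
    also have "\<dots> = (\<Sum>j<n. (R * D) $$ (l, j) * R $$ (l', j))"
    proof -
      define Q where "Q = R * D"
      have "Q \<in> carrier_mat k n" using R D by (simp add: Q_def)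
      then show ?thesis
        unfolding Q_def[symmetric] using R l by (simp add: scalar_prod_def lessThan_atLeast0)
    qed
    also have "\<dots> = (\<Sum>j<n. R $$ (l, j) * d j * R $$ (l', j))"
      by (intro sum.cong) (auto simp: RD)
    finally show "(\<Sum>j<n. (W\<^sup>T * S * U) $$ (l, j) * d j * (W\<^sup>T * S * U) $$ (l', j)) = (if l = l' then e l else 0)"
      using RDR l by (simp add: R_def[symmetric])
  next
    fix j assume "j < n"
    then have "d j \<in># eigs A" by (simp add: A.eigs)
    then show "d j = 0 \<or> L \<le> \<bar>d j\<bar>" using gap by auto
  next
    fix t :: real and x :: "nat \<Rightarrow> real" assume t: "L \<le> t" and supp: "\<And>j. j < n \<Longrightarrow> x j \<noteq> 0 \<Longrightarrow> t \<le> \<bar>d j\<bar>"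
    define v where "v = U *\<^sub>v vec n x"
    have v: "v \<in> carrier_vec n" using A.U by (auto simp: v_def)
    have vv: "v \<bullet> v = (\<Sum>j<n. (x j)\<^sup>2)"
      unfolding v_def using scalar_prod_orthogonal_mult[OF A.U A.UU, of "vec n x"]
      by (simp add: scalar_prod_vec_self)
    have "W\<^sup>T *\<^sub>v (S *\<^sub>v v) = R *\<^sub>v vec n x"
      unfolding R_def v_def using S A.U M.U
      by (simp add: assoc_mult_mat_vec[of _ k n _ n] assoc_mult_mat_vec[of _ k k _ n])
    also have "\<dots> = vec k (\<lambda>l. \<Sum>j<n. R $$ (l, j) * x j)"
      using R by (intro eq_vecI) (auto simp: scalar_prod_def lessThan_atLeast0)
    finally have "(S *\<^sub>v v) \<bullet> (S *\<^sub>v v) = (\<Sum>l<k. (\<Sum>j<n. R $$ (l, j) * x j)\<^sup>2)"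
      using scalar_prod_orthogonal_mult[of "W\<^sup>T" k k "S *\<^sub>v v"] M.U M.UU' S v
      by (simp add: scalar_prod_vec_self)
    moreover have "v \<in> top_eigspan A t" unfolding v_def using supp by (rule A.in_top_eigspan)
    ultimately show "\<bar>(\<Sum>l<k. (\<Sum>j<n. (W\<^sup>T * S * U) $$ (l, j) * x j)\<^sup>2) - (\<Sum>j<n. (x j)\<^sup>2)\<bar>
        \<le> min (L / t) (1/10) * (\<Sum>j<n. (x j)\<^sup>2)"
      using embed t unfolding assumption_L_def subspace_embedding_def vnorm_square R_def[symmetric] vv[symmetric]
      by (force simp: algebra_simps abs_le_iff)
  qed
qed

lemma transpose_sketch:
  fixes A S :: "real mat"
  assumes A: "A \<in> carrier_mat n n" "A\<^sup>T = A" and S: "S \<in> carrier_mat k n"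
  shows "(S * A * S\<^sup>T)\<^sup>T = S * A * S\<^sup>T"
proof -
  have "(S * A * S\<^sup>T)\<^sup>T = S * (A * S\<^sup>T)"
    using A S transpose_mult[of "S * A" k n "S\<^sup>T" k] transpose_mult[of S k n A n] by simp
  then show ?thesis using assoc_mult_mat[of S k n A n "S\<^sup>T" k] A S by simp
qed

lemma lam_sketch:
  assumes A: "A \<in> carrier_mat n n" "A\<^sup>T = A" and S: "S \<in> carrier_mat k n"
    and L: "0 < L" and eig_gap: "\<forall>x \<in># eigs A. x \<noteq> 0 \<longrightarrow> \<bar>x\<bar> \<ge> L" and embed: "assumption_L S A L"
    and i: "1 \<le> i" "i \<le> n" and pos: "0 < lam A i"
  shows "i \<le> size (eigs (S * A * S\<^sup>T)) \<and>
    \<bar>lam (S * A * S\<^sup>T) i - lam A i\<bar> \<le> 40 * L * ln (2 * opnorm A / L)"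
proof -
  define M where "M = S * A * S\<^sup>T"
  have M: "M \<in> carrier_mat k k" using A S by (simp add: M_def)
  have "M\<^sup>T = M"
    unfolding M_def by (rule transpose_sketch[OF A S])
  then obtain W e where "orthogonal_diagonalization M W k e"
    using symmetric_diagonalization_exists[OF M] by blast
  then interpret M: orthogonal_diagonalization M W k e .
  obtain U d where "orthogonal_diagonalization A U n d"
    using symmetric_diagonalization_exists[OF A] by blast
  then interpret A: orthogonal_diagonalization A U n d .
  interpret sketched_spectrum n k d e "\<lambda>l j. (W\<^sup>T * S * U) $$ (l, j)" L
    using sketched_spectrum_coordinates[of A U n d S k W e L] S L eig_gap embed
      A.orthogonal_diagonalization_axioms M.orthogonal_diagonalization_axioms
    by (simp add: M_def)
  define r where "r = lam A i"
  have r_in: "r \<in># eigs A" unfolding r_def using i by (intro lam_in_eigs) (auto simp: A.size_eigs)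
  then have r: "L \<le> r" using eig_gap pos by (force simp: r_def)
  obtain q where "q < n" "d q = r" using r_in by (auto simp: A.eigs)
  then have r_opnorm: "r \<le> opnorm A" using A.abs_le_opnorm[of q] by simp
  have above: "card {j. j < n \<and> r < d j} < i"
    using size_greater_lam[OF i(1), of A] by (simp add: A.size_filter r_def)
  have atleast: "i \<le> card {j. j < n \<and> r \<le> d j}"
    using size_ge_lam[OF i(1), of A] i by (simp add: A.size_filter A.size_eigs r_def)
  also have "\<dots> \<le> card {j. j < n \<and> 0 < d j}" using r L by (intro card_mono) auto
  also have "\<dots> \<le> card {l. l < k \<and> 0 < e l}" by (rule card_positive_le)
  finally have i_pos: "i \<le> card {l. l < k \<and> 0 < e l}" .
  also have "\<dots> \<le> card {..<k}" by (intro card_mono) auto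
  \<comment> \<open>\<open>lam M i\<close> reads a list at position \<open>i - 1\<close>; this bound
    puts that position in range.\<close>
  finally have ik: "i \<le> size (eigs M)" by (simp add: M.size_eigs)
  have "i \<le> size {#x \<in># eigs M. 0 \<le> x#}"
    unfolding M.size_filter by (rule order.trans[OF i_pos card_mono]) auto
  then have M_nonneg: "0 \<le> lam M i" by (rule lam_ge[OF i(1)])
  \<comment> \<open>For \<open>r\<close> below \<open>20 * L\<close>, nonnegativity of
    \<open>lam M i\<close> suffices, at the price of an error of \<open>20 * L\<close> in place of
    \<open>10 * L\<close>.\<close>
  have lower: "r - 20 * L \<le> lam M i"
  proof (cases "20 * L \<le> r")
    case True
    have "i \<le> size {#x \<in># eigs M. r - 10 * L \<le> x#}"
      unfolding M.size_filter using atleast card_lower_ge[OF True] by linarith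
    from lam_ge[OF i(1) this] show ?thesis using L by linarith
  next
    case False
    then show ?thesis using M_nonneg by linarith
  qed
  have upper: "lam M i \<le> r + L + L * ln (r / L)"
    using card_upper_le[OF r] above by (intro lam_le[OF i(1) ik]) (simp add: M.size_filter)
  define \<Lambda> where "\<Lambda> = ln (2 * opnorm A / L)"
  \<comment> \<open>Since \<open>L \<le> r \<le> opnorm A\<close>, \<Lambda> is at least
    \<open>ln 2\<close>, hence at least 1/2, and multiples of \<open>L\<close> are absorbed into
    \<open>L * \<Lambda>\<close>. The lower error \<open>20 * L\<close> dictates the constant
    40.\<close>
  have "ln 2 \<le> \<Lambda>"
    unfolding \<Lambda>_def using r r_opnorm L by (intro ln_mono) (auto simp: field_simps)
  moreover have "ln (1 / 2 :: real) \<le> 1 / 2 - 1" by (rule ln_le_minus_one) simp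
  ultimately have \<Lambda>: "1 / 2 \<le> \<Lambda>" by (simp add: ln_div)
  have "ln (r / L) \<le> \<Lambda>"
    unfolding \<Lambda>_def using r r_opnorm L by (intro ln_mono) (auto simp: divide_right_mono)
  then have "L * ln (r / L) \<le> L * \<Lambda>" using L by (intro mult_left_mono) auto
  moreover have "L * (1 / 2) \<le> L * \<Lambda>" using L \<Lambda> by (intro mult_left_mono) auto
  ultimately have "\<bar>lam M i - r\<bar> \<le> 40 * (L * \<Lambda>)" using lower upper L unfolding abs_le_iff by linarith
  then show ?thesis using ik by (simp add: M_def r_def \<Lambda>_def)
qed

section \<open>Negation of the matrix\<close>

lemma sorted_list_of_image_uminus:
  fixes X :: "real multiset"
  shows "sorted_list_of_multiset (image_mset uminus X) = rev (map uminus (sorted_list_of_multiset X))"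
proof -
  have "sorted (rev (map uminus (sorted_list_of_multiset X)))"
    unfolding sorted_wrt_rev sorted_wrt_map using sorted_sorted_list_of_multiset[of X] by simp
  moreover have "mset (rev (map uminus (sorted_list_of_multiset X))) = image_mset uminus X" by simp
  ultimately show ?thesis by (metis sorted_list_of_multiset_mset sorted_sort_id)
qed

lemma eigs_uminus:
  assumes A: "A \<in> carrier_mat n n" "A\<^sup>T = A"
  shows "eigs (- A) = image_mset uminus (eigs A)"
proof -
  obtain U d where "orthogonal_diagonalization A U n d"
    using symmetric_diagonalization_exists[OF A] by blast
  then interpret A: orthogonal_diagonalization A U n d .
  have "U\<^sup>T * (- A) * U = - (U\<^sup>T * A * U)" using A A.U by simp
  also have "\<dots> = mat n n (\<lambda>(i, j). if i = j then - d i else 0)"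
    unfolding A.diag by (intro eq_matI) auto
  finally have "eigs (- A) = image_mset (\<lambda>j. - d j) (mset_set {..<n})"
    using A A.U A.UU by (intro eigs_orthogonal_diagonalization) auto
  then show ?thesis by (simp add: A.eigs multiset.map_comp comp_def)
qed

text \<open>Negation reverses the order of the eigenvalues. The bound on \<open>i\<close> lets
  negation pass through list access, which holds at positions in range.\<close>

lemma lam_uminus:
  assumes A: "A \<in> carrier_mat n n" "A\<^sup>T = A" and i: "1 \<le> i" "i \<le> size (eigs A)"
  shows "lam (- A) i = - mu A i"
  using i unfolding lam_def mu_def eigs_uminus[OF A] sorted_list_of_image_uminus by simp

lemma eigenvector_uminus:
  fixes A :: "real mat"
  assumes "A \<in> carrier_mat n n"
  shows "eigenvector (- A) v c \<longleftrightarrow> eigenvector A v (- c)"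
proof -
  have "- A *\<^sub>v v = c \<cdot>\<^sub>v v \<longleftrightarrow> A *\<^sub>v v = - c \<cdot>\<^sub>v v" if "v \<in> carrier_vec n"
  proof -
    have "- A *\<^sub>v v = - (A *\<^sub>v v)" using assms that by simp
    moreover have "- c \<cdot>\<^sub>v v = - (c \<cdot>\<^sub>v v)" by (intro eq_vecI) auto
    ultimately show ?thesis by (metis uminus_uminus_vec)
  qed
  then show ?thesis using assms by (auto simp: eigenvector_def)
qed

text \<open>Assumption L sees only eigenvectors and the magnitudes of their eigenvalues, and
  negation keeps both.\<close>

lemma assumption_L_uminus:
  assumes "A \<in> carrier_mat n n"
  shows "assumption_L S (- A) L \<longleftrightarrow> assumption_L S A L"
proof -
  have "{v. \<exists>c. eigenvector (- A) v c \<and> \<bar>c\<bar> \<ge> t} = {v. \<exists>c. eigenvector A v c \<and> \<bar>c\<bar> \<ge> t}" for t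
    unfolding eigenvector_uminus[OF assms] by (metis abs_minus_cancel minus_minus)
  then show ?thesis by (simp add: assumption_L_def top_eigspan_def)
qed

lemma opnorm_uminus:
  assumes "A \<in> carrier_mat n n"
  shows "opnorm (- A) = opnorm A"
proof -
  have eq: "vnorm (- A *\<^sub>v v) = vnorm (A *\<^sub>v v)" if "v \<in> carrier_vec n" for v
    using assms that by (simp add: vnorm_def)
  have "{vnorm (- A *\<^sub>v v) | v. v \<in> carrier_vec (dim_col (- A)) \<and> vnorm v \<le> 1}
      = {vnorm (A *\<^sub>v v) | v. v \<in> carrier_vec (dim_col A) \<and> vnorm v \<le> 1}"
  proof (intro Collect_cong ex_cong1)
    fix x v
    show "x = vnorm (- A *\<^sub>v v) \<and> v \<in> carrier_vec (dim_col (- A)) \<and> vnorm v \<le> 1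
        \<longleftrightarrow> x = vnorm (A *\<^sub>v v) \<and> v \<in> carrier_vec (dim_col A) \<and> vnorm v \<le> 1"
      using eq[of v] assms by (cases "v \<in> carrier_vec n") auto
  qed
  then show ?thesis by (simp add: opnorm_def)
qed

theorem mainTheorem17:
  "\<exists>c::real > 0. \<forall>(n::nat) (k::nat) (L::real) (A::real mat) (S::real mat).
     A \<in> carrier_mat n n \<longrightarrow> A\<^sup>T = A \<longrightarrow> A \<noteq> 0\<^sub>m n n \<longrightarrow> L > 0 \<longrightarrow>
     (\<forall>x \<in># eigs A. x \<noteq> 0 \<longrightarrow> \<bar>x\<bar> \<ge> L) \<longrightarrow>
     S \<in> carrier_mat k n \<longrightarrow> assumption_L S A L \<longrightarrow>
     (\<forall>i. 1 \<le> i \<and> i \<le> n \<and> lam A i > 0 \<longrightarrow>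
         i \<le> size (eigs (S * A * S\<^sup>T)) \<and>
         \<bar>lam (S * A * S\<^sup>T) i - lam A i\<bar> \<le> c * L * ln (2 * opnorm A / L)) \<and>
     (\<forall>i. 1 \<le> i \<and> i \<le> n \<and> mu A i < 0 \<longrightarrow>
         i \<le> size (eigs (S * A * S\<^sup>T)) \<and>
         \<bar>mu (S * A * S\<^sup>T) i - mu A i\<bar> \<le> c * L * ln (2 * opnorm A / L))"
proof (intro exI[of _ 40] conjI allI impI)
  fix n k i :: nat and L :: real and A S :: "real mat"
  assume A: "A \<in> carrier_mat n n" "A\<^sup>T = A" and L: "0 < L"
    and gap: "\<forall>x \<in># eigs A. x \<noteq> 0 \<longrightarrow> \<bar>x\<bar> \<ge> L" and S: "S \<in> carrier_mat k n"
    and embed: "assumption_L S A L"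
  define M where "M = S * A * S\<^sup>T"
  {
    assume "1 \<le> i \<and> i \<le> n \<and> lam A i > 0"
    with lam_sketch[OF A S L gap embed, of i]
    show "i \<le> size (eigs (S * A * S\<^sup>T))"
      "\<bar>lam (S * A * S\<^sup>T) i - lam A i\<bar> \<le> 40 * L * ln (2 * opnorm A / L)"
      by auto
  next
    assume i: "1 \<le> i \<and> i \<le> n \<and> mu A i < 0"
    have M: "M \<in> carrier_mat k k" "M\<^sup>T = M"
      using A S transpose_sketch[OF A S] by (auto simp: M_def)
    have neg: "- A \<in> carrier_mat n n" "(- A)\<^sup>T = - A" using A by (auto simp: transpose_uminus)
    \<comment> \<open>Sketching commutes with negation, so the \<open>lam\<close> bound for
      \<open>- A\<close> is the \<open>mu\<close> bound for \<open>A\<close> with both signs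
      reversed.\<close>
    have SM: "S * (- A) * S\<^sup>T = - M" using A S by (simp add: M_def)
    obtain U d where "orthogonal_diagonalization A U n d"
      using symmetric_diagonalization_exists[OF A] by blast
    then have size: "size (eigs A) = n" by (rule orthogonal_diagonalization.size_eigs)
    have "\<forall>x \<in># eigs (- A). x \<noteq> 0 \<longrightarrow> \<bar>x\<bar> \<ge> L" using gap by (simp add: eigs_uminus[OF A])
    moreover have "0 < lam (- A) i" using i lam_uminus[OF A, of i] size by simp
    moreover have "assumption_L S (- A) L" using embed assumption_L_uminus[OF A(1)] by simp
    ultimately have *: "i \<le> size (eigs (- M))"
      "\<bar>lam (- M) i - lam (- A) i\<bar> \<le> 40 * L * ln (2 * opnorm A / L)"
      using lam_sketch[OF neg S L, of i] i unfolding SM opnorm_uminus[OF A(1)] by auto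
    then have "i \<le> size (eigs M)" by (simp add: eigs_uminus[OF M])
    with * show "i \<le> size (eigs (S * A * S\<^sup>T))"
      "\<bar>mu (S * A * S\<^sup>T) i - mu A i\<bar> \<le> 40 * L * ln (2 * opnorm A / L)"
      using lam_uminus[OF A, of i] lam_uminus[OF M, of i] size i
      by (auto simp: M_def[symmetric] abs_minus_commute)
  }
qed simp

end
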